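(* Let $d\ge 2$ and $1\le k\le d$ be integers. Let $X$ be a random vector in $\mathbb{R}^d$ with $\mathbb{E}X=0$, $\mathbb{E}\left[|X|^2\right]=\sigma^2 d$ (where $\sigma>0$), and $A:=\mathbb{E}\left||X|^2\sigma^{-2}-d\right|<\infty$. Let $\theta=(\theta_1,\ldots,\theta_k)$ be a random point of the Stiefel manifold $\mathfrak{W}_{d,k}$, distributed according to Haar measure and independent of $X$, and let $$X_\theta:=\big(\langle X,\theta_1\rangle,\ldots,\langle X,\theta_k\rangle\big).$$ Let $Z$ be a standard normal random vector in $\mathbb{R}^k$. Then $$d_W(X_\theta,\sigma Z)\le \frac{\sigma\sqrt{k}(A+1)+\sigma k}{d-1},$$ where the law of $X_\theta$ is the unconditional one, with both $X$ and $\theta$ random.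
   Context: $|\cdot|$ denotes the Euclidean norm. The Stiefel manifold is $\mathfrak{W}_{d,k}=\{\theta=(\theta_1,\ldots,\theta_k):\theta_i\in\mathbb{R}^d,\ \langle\theta_i,\theta_j\rangle=\delta_{ij}\text{ for all }1\le i,j\le k\}$; Haar measure on it is the unique rotation-invariant probability measure. The Wasserstein distance between random vectors $U,V$ in $\mathbb{R}^k$ is $d_W(U,V)=\sup\{|\mathbb{E}f(V)-\mathbb{E}f(U)|: f:\mathbb{R}^k\to\mathbb{R},\ |f(x)-f(y)|\le|x-y|\text{ for all }x,y\}$. *)

theory Defs
  imports "HOL-Probability.Probability"
begin

text \<open>A \<open>'k\<close>-frame in \<open>real ^ 'd\<close> is the matrix whose \<open>i\<close>-th row is the \<open>i\<close>-th frame vector.\<close>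

definition stiefel :: "(real ^ 'd ^ 'k) set" where
  "stiefel = {\<theta>. \<forall>i j. \<theta> $ i \<bullet> \<theta> $ j = (if i = j then 1 else 0)}"

abbreviation borel_stiefel :: "(real ^ 'd ^ 'k) measure" where
  "borel_stiefel \<equiv> restrict_space borel stiefel"

text \<open>
  Rotation-invariance means invariance under the whole orthogonal group, including reflections:
  when frames consist of \<open>CARD('d)\<close> vectors, the rotations of determinant 1 do not act
  transitively on frames and would not determine a unique invariant probability measure.
\<close>

definition stiefel_haar :: "(real ^ 'd ^ 'k) measure \<Rightarrow> bool" where
  "stiefel_haar \<mu> \<longleftrightarrow>
     prob_space \<mu> \<and> sets \<mu> = sets borel_stiefel \<and>
     (\<forall>f. orthogonal_transformation f \<longrightarrow> distr \<mu> \<mu> (\<lambda>\<theta>. \<chi> i. f (\<theta> $ i)) = \<mu>)"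

text \<open>
  The constant \<open>prob_space.indep_var\<close> forces both random variables to have the same type;
  this is its heterogeneous counterpart.
\<close>

definition (in prob_space) indep_pair ::
    "'b measure \<Rightarrow> ('a \<Rightarrow> 'b) \<Rightarrow> 'c measure \<Rightarrow> ('a \<Rightarrow> 'c) \<Rightarrow> bool" where
  "indep_pair S X T Y \<longleftrightarrow>
     random_variable S X \<and> random_variable T Y \<and>
     indep_set {X -` A \<inter> space M | A. A \<in> sets S} {Y -` B \<inter> space M | B. B \<in> sets T}"

definition (in prob_space) std_normal_vector :: "('a \<Rightarrow> real ^ 'k) \<Rightarrow> bool" where
  "std_normal_vector Z \<longleftrightarrow>
     indep_vars (\<lambda>_. borel) (\<lambda>i \<omega>. Z \<omega> $ i) UNIV \<and>
     (\<forall>i. distributed M lborel (\<lambda>\<omega>. Z \<omega> $ i) std_normal_density)"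

text \<open>
  The two random vectors may live on different probability spaces. The supremum is taken in
  \<open>ennreal\<close>, so that it is \<open>\<infinity>\<close> rather than an unspecified real if the set is unbounded. The
  Bochner integrals are the intended expectations for integrable \<open>U\<close> and \<open>V\<close>, since then every
  Lipschitz function of them is integrable.
\<close>

definition wasserstein_dist ::
    "'a measure \<Rightarrow> ('a \<Rightarrow> real ^ 'k) \<Rightarrow> 'b measure \<Rightarrow> ('b \<Rightarrow> real ^ 'k) \<Rightarrow> ennreal" where
  "wasserstein_dist M U N V =
     (SUP f \<in> {f :: real ^ 'k \<Rightarrow> real. \<forall>x y. \<bar>f x - f y\<bar> \<le> norm (x - y)}.
        ennreal \<bar>(\<integral>\<omega>. f (V \<omega>) \<partial>N) - (\<integral>\<omega>. f (U \<omega>) \<partial>M)\<bar>)"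

end

theory Submission
  imports Defs
begin

text \<open>
Stein's method, with the solution of the Stein equation replaced by a rotating path from the
projection to the Gaussian vector. Let \<open>W = X\<^sub>\<theta>\<close>, let \<open>Z\<close> be independent of \<open>(X, \<theta>)\<close>, and for a test
function \<open>g\<close> of class \<open>C\<^sup>2\<close> with \<open>\<bar>\<nabla>g\<bar> \<le> 1\<close> and bounded Hessian put
  \<open>Y\<^sub>\<phi> = cos \<phi> \<cdot> W + \<sigma> sin \<phi> \<cdot> Z\<close>  and  \<open>h(\<phi>) = E g(Y\<^sub>\<phi>)\<close> (\<open>path_mean\<close>).
Then \<open>h(0) = E g(W)\<close> and \<open>h(\<pi>/2) = E g(\<sigma>Z)\<close>, and it is enough to show that
\<open>\<bar>h'(\<phi>)\<bar> \<le> C cos \<phi>\<close>, where \<open>C\<close> is the claimed bound, because the integral of the cosine over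
\<open>[0, \<pi>/2]\<close> is 1. Differentiating,
  \<open>h'(\<phi>) = E[\<nabla>g(Y) \<bullet> (\<sigma> cos \<phi> \<cdot> Z - sin \<phi> \<cdot> W)]\<close>.

Two integrations by parts transform this expression. The first is the Gaussian one: given \<open>(X, \<theta>)\<close>,
  \<open>E[\<nabla>g(Y) \<bullet> Z] = \<sigma> sin \<phi> \<cdot> E[\<Delta>g(Y)]\<close>.
The second comes from the Haar measure (\<open>rotation_identity\<close>): rotating the frame by a small angle
in a coordinate plane does not change the joint law of \<open>X\<close> and \<open>\<theta>\<close>, so the derivative in the
angle of the expectation of any function of \<open>X\<close> and \<open>\<theta>\<close> vanishes. Applied to the angular velocity
of \<open>W\<close> paired with a vector field \<open>p\<close>, and summed over all coordinate planes, this says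
  \<open>(d - 1) E[p(W) \<bullet> W] = E[\<bar>X\<bar>\<^sup>2 div p(W) - W \<bullet> Dp(W) W]\<close>,
which is the divergence theorem for the Laplacian of the sphere. Taking for \<open>p\<close> the field \<open>\<nabla>g(Y)\<close>, as a function
of \<open>W\<close> with derivative \<open>cos \<phi> \<cdot> D\<^sup>2g(Y)\<close>, both terms of
\<open>h'\<close> become second order terms:
  \<open>(d - 1) h'(\<phi>) = sin \<phi> cos \<phi> \<cdot> E[a \<Delta>g(Y) + W \<bullet> D\<^sup>2g(Y) W]\<close>,  \<open>a = \<sigma>\<^sup>2(d - 1) - \<bar>X\<bar>\<^sup>2\<close>.
Gaussian integration by parts, used backwards, removes the Hessian of \<open>g\<close> again, at the price of
the factor \<open>\<sigma> sin \<phi>\<close>, which is exactly what is present: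
  \<open>\<sigma>(d - 1) h'(\<phi>) = cos \<phi> \<cdot> E[a \<nabla>g(Y) \<bullet> Z + (\<nabla>g(Y) \<bullet> W)(W \<bullet> Z)]\<close>.
Here \<open>a\<close> is \<open>radial_defect\<close>. Since \<open>\<bar>\<nabla>g\<bar> \<le> 1\<close>, the estimates
\<open>E\<bar>Z\<bar> \<le> \<surd>k\<close>, \<open>E\<bar>w \<bullet> Z\<bar> \<le> \<bar>w\<bar>\<close> and \<open>E\<bar>a\<bar> \<le> \<sigma>\<^sup>2(A + 1)\<close> bound the expectation
by \<open>\<sigma>\<^sup>2(A + 1)\<surd>k + E\<bar>W\<bar>\<^sup>2\<close>, and \<open>E\<bar>W\<bar>\<^sup>2 = \<sigma>\<^sup>2k\<close> is the rotation identity for the field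
\<open>p(w) = w\<close>.

A general Lipschitz function is uniformly close to a function of class \<open>C\<^sup>2\<close> that is still
1-Lipschitz (\<open>smooth_approximation\<close>): convolve it with a smooth kernel of small support. The
Hessian of the approximation is bounded, which justifies the interchanges of limits and
expectations.
\<close>

section \<open>Gradients, and integrals depending on a parameter\<close>

lemma GDERIV_along_curve:
  assumes "GDERIV f (\<gamma> t) :> D" "(\<gamma> has_vector_derivative v) (at t)"
  shows "((\<lambda>s. f (\<gamma> s)) has_real_derivative (v \<bullet> D)) (at t)"
proof -
  have "((\<lambda>s. f (\<gamma> s)) has_derivative (\<lambda>h. (h *\<^sub>R v) \<bullet> D)) (at t)"
    using has_derivative_compose[OF assms(2)[unfolded has_vector_derivative_def] assms(1)[unfolded gderiv_def]]
    by simp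
  moreover have "(\<lambda>h. (h *\<^sub>R v) \<bullet> D) = (*) (v \<bullet> D)" by (auto simp: mult.commute)
  ultimately show ?thesis by (simp add: has_field_derivative_def)
qed

lemma GDERIV_imp_continuous_on:
  assumes "\<And>x. GDERIV f x :> D x"
  shows "continuous_on UNIV f"
  using assms unfolding gderiv_def
  by (meson continuous_at_imp_continuous_on has_derivative_continuous)

lemma GDERIV_vec_nth: "GDERIV (\<lambda>u. u $ i) (u :: real ^ 'k) :> axis i 1"
  unfolding gderiv_def inner_axis
  using bounded_linear_vec_nth[THEN bounded_linear_imp_has_derivative, of i] by simp

lemma bounded_gradient_imp_lipschitz:
  assumes f: "\<And>x. GDERIV f x :> D x" and D: "\<And>x. norm (D x) \<le> L"
  shows "\<bar>f x - f y\<bar> \<le> L * norm (x - y)"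
proof -
  have "norm (f x - f y) \<le> L * norm (x - y)"
  proof (rule differentiable_bound[where S=UNIV])
    fix z show "(f has_derivative (\<lambda>h. h \<bullet> D z)) (at z within UNIV)"
      using f[of z] by (simp add: gderiv_def)
    show "onorm (\<lambda>h. h \<bullet> D z) \<le> L"
    proof (rule onorm_bound)
      show "0 \<le> L" using D[of z] norm_ge_zero order_trans by blast
      fix h show "norm (h \<bullet> D z) \<le> L * norm h"
        using Cauchy_Schwarz_ineq2[of h "D z"] mult_left_mono[OF D[of z], of "norm h"]
        by (simp add: mult.commute)
    qed
  qed auto
  then show ?thesis by simp
qed

text \<open>
The difference quotient in the direction of the gradient tends to the norm of the gradient, so a
Lipschitz estimate with one end fixed at \<open>x\<close> bounds the gradient at \<open>x\<close>.
\<close>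

lemma norm_gradient_le:
  assumes f: "GDERIV f x :> D" and "\<delta> > 0" "0 \<le> L"
    and lip: "\<And>y. y \<in> ball x \<delta> \<Longrightarrow> \<bar>f y - f x\<bar> \<le> L * norm (y - x)"
  shows "norm D \<le> L"
proof (cases "D = 0")
  case True
  then show ?thesis using assms by simp
next
  case False
  have "((\<lambda>s. x + s *\<^sub>R D) has_vector_derivative D) (at 0)"
    by (auto intro!: derivative_eq_intros)
  from GDERIV_along_curve[OF _ this, of f D] f
  have "((\<lambda>s. f (x + s *\<^sub>R D)) has_real_derivative (D \<bullet> D)) (at 0)" by simp
  then have lim: "(\<lambda>s. (f (x + s *\<^sub>R D) - f x) / s) \<midarrow>0\<rightarrow> D \<bullet> D"
    by (simp add: DERIV_def)
  have "\<forall>\<^sub>F s in at 0. (f (x + s *\<^sub>R D) - f x) / s \<le> L * norm D"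
    unfolding eventually_at
  proof (intro exI[of _ "\<delta> / norm D"] conjI ballI impI)
    show "0 < \<delta> / norm D" using False assms by simp
    fix s :: real assume s: "s \<noteq> 0 \<and> dist s 0 < \<delta> / norm D"
    then have "x + s *\<^sub>R D \<in> ball x \<delta>" using False by (simp add: dist_norm field_simps)
    from lip[OF this] have "\<bar>f (x + s *\<^sub>R D) - f x\<bar> \<le> L * norm D * \<bar>s\<bar>" by (simp add: mult.assoc mult.left_commute mult.commute)
    then have "\<bar>(f (x + s *\<^sub>R D) - f x) / s\<bar> \<le> L * norm D" using s by (simp add: divide_le_eq)
    then show "(f (x + s *\<^sub>R D) - f x) / s \<le> L * norm D" by linarith
  qed
  from tendsto_upperbound[OF lim this] have "norm D * norm D \<le> L * norm D"
    by (simp add: dot_square_norm power2_eq_square)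
  then show ?thesis using False by simp
qed

text \<open>
Dominated convergence along sequences tending to \<open>x0\<close>: the remainder quotients are at most twice
the local Lipschitz constant \<open>B\<close>. With \<open>'b = real\<close>, this also differentiates expectations along a
one-parameter family.
\<close>

lemma GDERIV_integral:
  fixes \<phi> :: "'b::euclidean_space \<Rightarrow> 'a \<Rightarrow> real"
  assumes "\<delta> > 0"
    and int: "\<And>x. x \<in> ball x0 \<delta> \<Longrightarrow> integrable M (\<phi> x)"
    and grad: "\<And>\<omega>. \<omega> \<in> space M \<Longrightarrow> GDERIV (\<lambda>x. \<phi> x \<omega>) x0 :> D \<omega>"
    and D[measurable]: "D \<in> borel_measurable M"
    and B: "integrable M B" "\<And>\<omega>. \<omega> \<in> space M \<Longrightarrow> 0 \<le> B \<omega>"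
    and lip: "\<And>x \<omega>. x \<in> ball x0 \<delta> \<Longrightarrow> \<omega> \<in> space M \<Longrightarrow> \<bar>\<phi> x \<omega> - \<phi> x0 \<omega>\<bar> \<le> B \<omega> * norm (x - x0)"
  shows "integrable M D" and "GDERIV (\<lambda>x. \<integral>\<omega>. \<phi> x \<omega> \<partial>M) x0 :> (\<integral>\<omega>. D \<omega> \<partial>M)"
proof -
  have DB: "norm (D \<omega>) \<le> B \<omega>" if "\<omega> \<in> space M" for \<omega>
    using norm_gradient_le[OF grad[OF that] \<open>\<delta> > 0\<close> B(2)[OF that] lip[OF _ that]] by simp
  show iD: "integrable M D"
    by (rule Bochner_Integration.integrable_bound[OF B(1)])
       (use DB B(2) in \<open>auto intro!: AE_I2\<close>)
  define q where "q x \<omega> = (\<phi> x \<omega> - \<phi> x0 \<omega> - (x - x0) \<bullet> D \<omega>) /\<^sub>R norm (x - x0)" for x \<omega>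
  have x0: "x0 \<in> ball x0 \<delta>" using \<open>\<delta> > 0\<close> by simp
  have qlim: "((\<lambda>x. q x \<omega>) \<longlongrightarrow> 0) (at x0)" if "\<omega> \<in> space M" for \<omega>
    using grad[OF that] unfolding gderiv_def has_derivative_at_within q_def by simp
  have qB: "norm (q x \<omega>) \<le> 2 * B \<omega>" if "x \<in> ball x0 \<delta>" "\<omega> \<in> space M" for x \<omega>
  proof (cases "x = x0")
    case True then show ?thesis using B(2)[OF that(2)] by (simp add: q_def)
  next
    case False
    have "\<bar>(x - x0) \<bullet> D \<omega>\<bar> \<le> norm (x - x0) * B \<omega>"
      using Cauchy_Schwarz_ineq2[of "x - x0" "D \<omega>"] DB[OF that(2)]
      by (meson mult_left_mono norm_ge_zero order_trans)
    then have "\<bar>\<phi> x \<omega> - \<phi> x0 \<omega> - (x - x0) \<bullet> D \<omega>\<bar> \<le> 2 * B \<omega> * norm (x - x0)"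
      using lip[OF that] by (simp add: algebra_simps)
    then show ?thesis using False by (simp add: q_def field_simps)
  qed
  have qint: "(\<integral>\<omega>. q x \<omega> \<partial>M) = ((\<integral>\<omega>. \<phi> x \<omega> \<partial>M) - (\<integral>\<omega>. \<phi> x0 \<omega> \<partial>M) - (x - x0) \<bullet> (\<integral>\<omega>. D \<omega> \<partial>M)) /\<^sub>R norm (x - x0)"
    if "x \<in> ball x0 \<delta>" for x
    using int[OF that] int[OF x0] iD by (simp add: q_def)
  have "((\<lambda>x. \<integral>\<omega>. q x \<omega> \<partial>M) \<longlongrightarrow> 0) (at x0)"
    unfolding tendsto_at_iff_sequentially
  proof (intro allI impI)
    fix X assume X: "\<forall>i. X i \<in> UNIV - {x0}" "X \<longlonglongrightarrow> x0"
    from X(2) \<open>\<delta> > 0\<close> obtain n where n: "\<And>i. i \<ge> n \<Longrightarrow> X i \<in> ball x0 \<delta>"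
      by (metis (no_types, lifting) dist_commute lim_sequentially mem_ball)
    have "(\<lambda>i. \<integral>\<omega>. q (X (i + n)) \<omega> \<partial>M) \<longlonglongrightarrow> (\<integral>\<omega>. 0 \<partial>M)"
    proof (rule integral_dominated_convergence[where w="\<lambda>\<omega>. 2 * B \<omega>"])
      fix i
      have "\<phi> (X (i + n)) \<in> borel_measurable M" "\<phi> x0 \<in> borel_measurable M"
        using int[OF n[of "i+n"]] int[OF x0] by auto
      then show "(\<lambda>\<omega>. q (X (i + n)) \<omega>) \<in> borel_measurable M" unfolding q_def by measurable
      show "AE \<omega> in M. norm (q (X (i + n)) \<omega>) \<le> 2 * B \<omega>"
        using qB n[of "i+n"] by auto
    next
      have lim: "(\<lambda>i. X (i + n)) \<longlonglongrightarrow> x0" by (rule LIMSEQ_ignore_initial_segment[OF X(2)])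
      show "AE \<omega> in M. (\<lambda>i. q (X (i + n)) \<omega>) \<longlonglongrightarrow> 0"
      proof (rule AE_I2)
        fix \<omega> assume "\<omega> \<in> space M"
        from qlim[OF this, unfolded tendsto_at_iff_sequentially, rule_format, of "\<lambda>i. X (i + n)"] lim X(1)
        show "(\<lambda>i. q (X (i + n)) \<omega>) \<longlonglongrightarrow> 0" by (simp add: comp_def)
      qed
    qed (use B in auto)
    then show "((\<lambda>x. \<integral>\<omega>. q x \<omega> \<partial>M) \<circ> X) \<longlonglongrightarrow> 0"
      using LIMSEQ_offset[of "\<lambda>i. \<integral>\<omega>. q (X i) \<omega> \<partial>M" n 0] by (simp add: comp_def)
  qed
  moreover have "\<forall>\<^sub>F x in at x0. (\<integral>\<omega>. q x \<omega> \<partial>M) =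
     ((\<integral>\<omega>. \<phi> x \<omega> \<partial>M) - (\<integral>\<omega>. \<phi> x0 \<omega> \<partial>M) - (x - x0) \<bullet> (\<integral>\<omega>. D \<omega> \<partial>M)) /\<^sub>R norm (x - x0)"
    using qint \<open>\<delta> > 0\<close> unfolding eventually_at by (auto intro!: exI[of _ \<delta>] simp: dist_commute)
  ultimately have "((\<lambda>x. ((\<integral>\<omega>. \<phi> x \<omega> \<partial>M) - (\<integral>\<omega>. \<phi> x0 \<omega> \<partial>M) - (x - x0) \<bullet> (\<integral>\<omega>. D \<omega> \<partial>M)) /\<^sub>R norm (x - x0)) \<longlongrightarrow> 0) (at x0)"
    by (rule Lim_transform_eventually)
  then show "GDERIV (\<lambda>x. \<integral>\<omega>. \<phi> x \<omega> \<partial>M) x0 :> (\<integral>\<omega>. D \<omega> \<partial>M)"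
    unfolding gderiv_def has_derivative_at_within by (auto intro: bounded_linear_inner_left)
qed

lemma trig_lipschitz: "\<bar>cos x - cos y\<bar> \<le> \<bar>x - y\<bar>" "\<bar>sin x - sin y\<bar> \<le> \<bar>x - y\<bar>" for x y :: real
proof -
  have "norm (cos x - cos y) \<le> 1 * norm (x - y)"
    by (rule field_differentiable_bound[where S=UNIV and f'="\<lambda>x. - sin x"])
       (auto intro!: derivative_eq_intros)
  moreover have "norm (sin x - sin y) \<le> 1 * norm (x - y)"
    by (rule field_differentiable_bound[where S=UNIV and f'=cos])
       (auto intro!: derivative_eq_intros)
  ultimately show "\<bar>cos x - cos y\<bar> \<le> \<bar>x - y\<bar>" "\<bar>sin x - sin y\<bar> \<le> \<bar>x - y\<bar>" by simp_all
qed

lemma abs_integral_le: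
  fixes f g :: "'a \<Rightarrow> real"
  assumes "integrable M f" "integrable M g" "\<And>x. \<bar>f x\<bar> \<le> g x"
  shows "\<bar>\<integral>x. f x \<partial>M\<bar> \<le> (\<integral>x. g x \<partial>M)"
  by (rule order_trans[OF integral_abs_bound integral_mono]) (use assms in auto)

lemma lipschitz_imp_continuous_on:
  fixes f :: "'a::real_normed_vector \<Rightarrow> real"
  assumes "\<And>x y. \<bar>f x - f y\<bar> \<le> norm (x - y)"
  shows "continuous_on UNIV f"
  using assms by (auto intro!: lipschitz_on_continuous_on[of 1] lipschitz_onI simp: dist_norm)

lemma (in prob_space) integrable_lipschitz_comp:
  fixes f :: "'c::euclidean_space \<Rightarrow> real"
  assumes f: "\<And>x y. \<bar>f x - f y\<bar> \<le> norm (x - y)"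
    and [measurable]: "U \<in> borel_measurable M" and U: "integrable M (\<lambda>\<omega>. norm (U \<omega>))"
  shows "integrable M (\<lambda>\<omega>. f (U \<omega>))"
proof (rule Bochner_Integration.integrable_bound)
  have [measurable]: "f \<in> borel_measurable borel"
    using lipschitz_imp_continuous_on[OF f] by (rule borel_measurable_continuous_onI)
  show "(\<lambda>\<omega>. f (U \<omega>)) \<in> borel_measurable M" by measurable
  show "integrable M (\<lambda>\<omega>. \<bar>f 0\<bar> + norm (U \<omega>))" using U by simp
  show "AE \<omega> in M. norm (f (U \<omega>)) \<le> norm (\<bar>f 0\<bar> + norm (U \<omega>))"
  proof (rule AE_I2)
    fix \<omega> show "norm (f (U \<omega>)) \<le> norm (\<bar>f 0\<bar> + norm (U \<omega>))" using f[of "U \<omega>" 0] by simp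
  qed
qed

lemma borel_measurable_vecI:
  fixes f :: "'a \<Rightarrow> real ^ 'k"
  assumes "\<And>i. (\<lambda>\<omega>. f \<omega> $ i) \<in> borel_measurable M"
  shows "f \<in> borel_measurable M"
  using assms by (subst borel_measurable_euclidean_space) (auto simp: Basis_vec_def inner_axis)

lemma borel_measurable_vec_nth[measurable (raw)]:
  fixes f :: "'a \<Rightarrow> 'b::euclidean_space ^ 'k"
  assumes "f \<in> borel_measurable M"
  shows "(\<lambda>\<omega>. f \<omega> $ i) \<in> borel_measurable M"
  using measurable_compose[OF assms borel_measurable_continuous_onI[of "\<lambda>v. v $ i"]]
  by (simp add: continuous_on_component continuous_on_id)

section \<open>Approximation of Lipschitz functions by functions of class \<open>C\<^sup>2\<close>\<close>

lemma integrable_continuous_times_compact_support: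
  fixes f :: "'a::euclidean_space \<Rightarrow> real" and \<kappa> :: "'a \<Rightarrow> 'b::euclidean_space"
  assumes "continuous_on UNIV f" "continuous_on UNIV \<kappa>" "\<And>u. u \<notin> cball 0 1 \<Longrightarrow> \<kappa> u = 0"
  shows "integrable lborel (\<lambda>u. f (x + u) *\<^sub>R \<kappa> u)"
proof -
  have "integrable lborel (\<lambda>u. indicator (cball 0 1) u *\<^sub>R (f (x + u) *\<^sub>R \<kappa> u))"
    using assms(1,2) by (intro borel_integrable_compact)
      (auto intro!: continuous_intros continuous_on_compose2[OF assms(1)] continuous_on_subset[OF assms(2)])
  also have "(\<lambda>u. indicator (cball 0 1) u *\<^sub>R (f (x + u) *\<^sub>R \<kappa> u)) = (\<lambda>u. f (x + u) *\<^sub>R \<kappa> u)"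
    using assms(3) by (auto simp: indicator_def fun_eq_iff)
  finally show ?thesis .
qed

text \<open>
The smoothing is written \<open>\<integral> f (x + u) \<kappa> u du\<close>, so that the kernel does not move with \<open>x\<close> and every
estimate of \<open>f (x + u) - f (y + u)\<close> passes to the integral. Applied to the derivatives of a kernel,
this bounds the derivatives of the smoothed function even though \<open>f\<close> itself is unbounded.
\<close>

lemma smoothing_lipschitz:
  fixes f :: "'a::euclidean_space \<Rightarrow> real" and \<kappa> :: "'a \<Rightarrow> 'b::euclidean_space"
  assumes f: "\<And>x y. \<bar>f x - f y\<bar> \<le> norm (x - y)"
    and \<kappa>: "continuous_on UNIV \<kappa>" "\<And>u. u \<notin> cball 0 1 \<Longrightarrow> \<kappa> u = 0"
  shows "norm ((\<integral>u. f (x + u) *\<^sub>R \<kappa> u \<partial>lborel) - (\<integral>u. f (y + u) *\<^sub>R \<kappa> u \<partial>lborel))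
    \<le> (\<integral>u. norm (\<kappa> u) \<partial>lborel) * norm (x - y)"
proof -
  have cf: "continuous_on UNIV f" by (rule lipschitz_imp_continuous_on[OF f])
  note I = integrable_continuous_times_compact_support[OF cf \<kappa>]
  have I1: "integrable lborel (\<lambda>u. norm (\<kappa> u))"
    using integrable_continuous_times_compact_support[of "\<lambda>_. 1", OF _ \<kappa>] by simp
  have "norm ((\<integral>u. f (x + u) *\<^sub>R \<kappa> u \<partial>lborel) - (\<integral>u. f (y + u) *\<^sub>R \<kappa> u \<partial>lborel))
     = norm (\<integral>u. f (x + u) *\<^sub>R \<kappa> u - f (y + u) *\<^sub>R \<kappa> u \<partial>lborel)"
    using I by simp
  also have "\<dots> \<le> (\<integral>u. norm (x - y) * norm (\<kappa> u) \<partial>lborel)"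
  proof (rule Bochner_Integration.integral_norm_bound_integral)
    fix u
    show "norm (f (x + u) *\<^sub>R \<kappa> u - f (y + u) *\<^sub>R \<kappa> u) \<le> norm (x - y) * norm (\<kappa> u)"
      using f[of "x + u" "y + u"] by (auto simp flip: scaleR_left_diff_distrib intro: mult_right_mono)
  qed (use I I1 in auto)
  finally show ?thesis by (simp add: mult.commute)
qed

text \<open>
After the substitution \<open>y = x + u\<close> the variable \<open>x\<close> occurs in the kernel \<open>\<kappa> (y - x)\<close> only, so the
derivative falls on the kernel; this also explains the minus sign.
\<close>

lemma smoothing_GDERIV:
  fixes f \<kappa> :: "'a::euclidean_space \<Rightarrow> real"
  assumes f: "continuous_on UNIV f"
    and \<kappa>: "\<And>u. GDERIV \<kappa> u :> D\<kappa> u" "continuous_on UNIV D\<kappa>"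
      "\<And>u. u \<notin> cball 0 1 \<Longrightarrow> \<kappa> u = 0" "\<And>u. u \<notin> cball 0 1 \<Longrightarrow> D\<kappa> u = 0"
  shows "GDERIV (\<lambda>x. \<integral>u. f (x + u) * \<kappa> u \<partial>lborel) x0 :> (\<integral>u. f (x0 + u) *\<^sub>R (- D\<kappa> u) \<partial>lborel)"
proof -
  have c\<kappa>: "continuous_on UNIV \<kappa>" by (rule GDERIV_imp_continuous_on[OF \<kappa>(1)])
  have shift: "(\<integral>u. h (x + u) \<partial>lborel) = (\<integral>y. h y \<partial>lborel)" if "h \<in> borel_measurable borel" for h :: "'a \<Rightarrow> 'c::euclidean_space" and x
    using integral_distr[of "(+) x" lborel borel h] that by (simp add: lborel_distr_plus)
  have shift_int: "integrable lborel (\<lambda>y. h y) " if "integrable lborel (\<lambda>u. h (x + u))" "h \<in> borel_measurable borel" for h :: "'a \<Rightarrow> 'c::euclidean_space" and x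
    using integrable_distr_eq[of "(+) x" lborel borel h] that by (simp add: lborel_distr_plus)
  have mf[measurable]: "f \<in> borel_measurable borel" "\<kappa> \<in> borel_measurable borel" "D\<kappa> \<in> borel_measurable borel"
    using f c\<kappa> \<kappa>(2) by (auto intro: borel_measurable_continuous_onI)
  obtain L where L: "L \<ge> 0" "\<And>u. norm (D\<kappa> u) \<le> L"
  proof -
    have "compact (D\<kappa> ` cball 0 1)"
      using \<kappa>(2) by (intro compact_continuous_image) (auto intro: continuous_on_subset)
    then obtain b where "\<forall>v\<in>D\<kappa> ` cball 0 1. norm v \<le> b" using compact_imp_bounded bounded_iff by blast
    then have "norm (D\<kappa> u) \<le> max b 0" for u using \<kappa>(4)[of u] by (cases "u \<in> cball 0 1") (auto simp: max.coboundedI1)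
    then show ?thesis by (intro that[of "max b 0"]) auto
  qed
  have lip: "\<bar>\<kappa> u - \<kappa> v\<bar> \<le> L * norm (u - v)" for u v
    by (rule bounded_gradient_imp_lipschitz[OF \<kappa>(1) L(2)])
  define \<phi> where "\<phi> x y = f y * \<kappa> (y - x)" for x y
  have "GDERIV (\<lambda>x. \<integral>y. \<phi> x y \<partial>lborel) x0 :> (\<integral>y. f y *\<^sub>R (- D\<kappa> (y - x0)) \<partial>lborel)"
  proof (rule GDERIV_integral[where \<delta>=1 and B="\<lambda>y. indicator (cball x0 2) y * (\<bar>f y\<bar> * L)"])
    show "integrable lborel (\<phi> x)" for x
    proof (rule shift_int)
      show "integrable lborel (\<lambda>u. \<phi> x (x + u))"
        using integrable_continuous_times_compact_support[OF f c\<kappa> \<kappa>(3)] by (simp add: \<phi>_def)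
    qed (simp add: \<phi>_def)
    show "integrable lborel (\<lambda>y. indicator (cball x0 2) y * (\<bar>f y\<bar> * L))"
    proof -
      have "continuous_on (cball x0 2) (\<lambda>y. \<bar>f y\<bar> * L)"
        using continuous_on_subset[OF f] by (intro continuous_on_mult continuous_on_rabs continuous_on_const) auto
      from borel_integrable_compact[OF compact_cball this] show ?thesis by simp
    qed
    show "GDERIV (\<lambda>x. \<phi> x y) x0 :> f y *\<^sub>R (- D\<kappa> (y - x0))" for y
    proof -
      have "((\<lambda>x. \<kappa> (y - x)) has_derivative (\<lambda>h. (- h) \<bullet> D\<kappa> (y - x0))) (at x0)"
      proof (rule has_derivative_compose[OF _ \<kappa>(1)[unfolded gderiv_def]])
        show "((\<lambda>x. y - x) has_derivative (\<lambda>h. - h)) (at x0)" by (auto intro!: derivative_eq_intros)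
      qed
      then have "((\<lambda>x. f y * \<kappa> (y - x)) has_derivative (\<lambda>h. f y * ((- h) \<bullet> D\<kappa> (y - x0)))) (at x0)"
        by (rule has_derivative_mult_right)
      then show ?thesis by (simp add: gderiv_def \<phi>_def)
    qed
    fix x y assume x: "x \<in> ball x0 1"
    show "\<bar>\<phi> x y - \<phi> x0 y\<bar> \<le> indicator (cball x0 2) y * (\<bar>f y\<bar> * L) * norm (x - x0)"
    proof (cases "y \<in> cball x0 2")
      case True
      have "\<bar>\<phi> x y - \<phi> x0 y\<bar> = \<bar>f y\<bar> * \<bar>\<kappa> (y - x) - \<kappa> (y - x0)\<bar>"
        by (simp add: \<phi>_def abs_mult flip: right_diff_distrib)
      also have "\<dots> \<le> \<bar>f y\<bar> * (L * norm (x - x0))"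
        using lip[of "y - x" "y - x0"] by (intro mult_left_mono) (auto simp: norm_minus_commute)
      finally show ?thesis using True by simp
    next
      case False
      then have "dist x0 y > 2" by simp
      moreover have "dist x0 x < 1" using x by simp
      ultimately have "dist x y > 1" using dist_triangle[of x0 y x] by linarith
      then have "\<kappa> (y - x) = 0" "\<kappa> (y - x0) = 0" using \<open>dist x0 y > 2\<close>
        by (auto intro!: \<kappa>(3) simp: dist_norm norm_minus_commute)
      then show ?thesis using False by (simp add: \<phi>_def)
    qed
  qed (use L in auto)
  moreover have "(\<integral>y. \<phi> x y \<partial>lborel) = (\<integral>u. f (x + u) * \<kappa> u \<partial>lborel)" for x
  proof -
    have "\<phi> x \<in> borel_measurable borel" unfolding \<phi>_def by measurable
    from shift[OF this, of x] show ?thesis by (simp add: \<phi>_def)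
  qed
  moreover have "(\<integral>y. f y *\<^sub>R (- D\<kappa> (y - x0)) \<partial>lborel) = (\<integral>u. f (x0 + u) *\<^sub>R (- D\<kappa> u) \<partial>lborel)"
    using shift[of "\<lambda>y. f y *\<^sub>R (- D\<kappa> (y - x0))" x0] by simp
  ultimately show ?thesis by simp
qed

text \<open>
Up to a factor, the derivative of \<open>bump n\<close> is \<open>bump (n - 1) u\<close> times \<open>u\<close>; hence \<open>bump 3\<close> is of
class \<open>C\<^sup>2\<close>, while it is supported in the unit ball and elementary to differentiate.
\<close>

definition bump :: "nat \<Rightarrow> 'a::real_inner \<Rightarrow> real" where
  "bump n u = max 0 (1 - u \<bullet> u) ^ n"

lemma DERIV_positive_part_power:
  "((\<lambda>s::real. max 0 s ^ Suc (Suc n)) has_real_derivative real (n + 2) * max 0 s ^ Suc n) (at s)"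
proof -
  consider "s < 0" | "s > 0" | "s = 0" by linarith
  then show ?thesis
  proof cases
    case 1
    have "((\<lambda>s::real. 0) has_real_derivative 0) (at s)" by simp
    from has_field_derivative_transform_within_open[OF this, of "{..<0}"] 1
    show ?thesis by (simp add: max_def)
  next
    case 2
    have "((\<lambda>s::real. s ^ Suc (Suc n)) has_real_derivative real (n + 2) * s ^ Suc n) (at s)"
      by (rule DERIV_cong[OF DERIV_pow]) simp
    from has_field_derivative_transform_within_open[OF this, of "{0<..}"] 2
    show ?thesis by (simp add: max_def)
  next
    case 3
    have "(\<lambda>h::real. max 0 h ^ Suc n) \<midarrow>0\<rightarrow> max 0 0 ^ Suc n"
      by (intro tendsto_intros)
    moreover have "\<forall>\<^sub>F h::real in at 0. max 0 h ^ Suc n = (max 0 (0 + h) ^ Suc (Suc n) - max 0 0 ^ Suc (Suc n)) / h"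
      unfolding eventually_at by (intro exI[of _ 1]) (auto simp: max_def)
    ultimately have "(\<lambda>h::real. (max 0 (0 + h) ^ Suc (Suc n) - max 0 0 ^ Suc (Suc n)) / h) \<midarrow>0\<rightarrow> 0"
      using Lim_transform_eventually by fastforce
    then show ?thesis using 3 by (simp add: DERIV_def)
  qed
qed

lemma GDERIV_bump:
  "GDERIV (bump (Suc (Suc n))) u :> (- 2 * real (n + 2) * bump (Suc n) u) *\<^sub>R u"
proof -
  have "GDERIV (\<lambda>u. 1 - u \<bullet> u) u :> (- 2) *\<^sub>R u"
    unfolding gderiv_def by (auto intro!: derivative_eq_intros simp: inner_commute)
  from GDERIV_subst[OF GDERIV_DERIV_compose[OF this DERIV_positive_part_power[of n]]]
  show ?thesis unfolding bump_def by (simp add: algebra_simps)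
qed

lemma bump_nonneg: "0 \<le> bump n u" by (simp add: bump_def)

lemma bump_eq_0: "u \<notin> cball 0 1 \<Longrightarrow> n \<noteq> 0 \<Longrightarrow> bump n u = 0"
  using power2_norm_eq_inner[of u] one_less_power[of "norm u" 2] by (simp add: bump_def max_def)

lemma continuous_bump: "continuous_on A (bump n)"
  unfolding bump_def by (intro continuous_intros)

lemma integral_bump_pos: "0 < (\<integral>u. bump n (u::'a::euclidean_space) \<partial>lborel)" if "n \<noteq> 0"
proof -
  have I: "integrable lborel (bump n :: 'a \<Rightarrow> real)"
    using integrable_continuous_times_compact_support[of "\<lambda>_. 1" "bump n :: 'a \<Rightarrow> real"] that
    by (auto simp: continuous_bump bump_eq_0)
  \<comment> \<open>On the ball of radius 1/2, \<open>1 - u \<bullet> u \<ge> 3/4\<close>.\<close>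
  have "0 < (3/4)^n * measure lborel (ball (0::'a) (1/2))"
    using content_ball_pos[of "1/2" "0::'a"] by simp
  also have "\<dots> = (\<integral>u. (3/4)^n * indicator (ball (0::'a) (1/2)) u \<partial>lborel)" by simp
  also have "\<dots> \<le> (\<integral>u. bump n (u::'a) \<partial>lborel)"
  proof (rule integral_mono)
    show "integrable lborel (\<lambda>u::'a. (3/4)^n * indicator (ball 0 (1/2)) u :: real)"
      by (intro integrable_mult_right integrable_real_indicator)
        (use emeasure_bounded_finite[OF bounded_ball, of "0::'a" "1/2"] in auto)
    fix u :: 'a
    show "(3/4)^n * indicator (ball 0 (1/2)) u \<le> bump n u"
    proof (cases "norm u < 1/2")
      case True
      then have "u \<bullet> u \<le> (1/2)^2" unfolding power2_norm_eq_inner[symmetric] by (intro power_mono) auto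
      then have "(3/4)^n \<le> max 0 (1 - u \<bullet> u) ^ n" by (intro power_mono) (auto simp: power2_eq_square)
      then show ?thesis using True by (simp add: bump_def)
    qed (simp add: bump_nonneg)
  qed (fact I)
  finally show ?thesis .
qed

text \<open>
Convolution with the normalised kernel \<open>bump 3\<close>. It is a probability density on the unit ball, so
averaging preserves the Lipschitz constant and moves the values by at most 1. Minus the gradient of
the kernel is called \<open>V\<close>, and \<open>W i\<close> is the gradient of the component \<open>i\<close> of \<open>V\<close>.
\<close>

lemma smooth_approximation_within_1:
  fixes f :: "real ^ 'k \<Rightarrow> real"
  assumes f: "\<And>x y. \<bar>f x - f y\<bar> \<le> norm (x - y)"
  obtains g :: "real ^ 'k \<Rightarrow> real" and p :: "real ^ 'k \<Rightarrow> real ^ 'k" and H :: "'k \<Rightarrow> real ^ 'k \<Rightarrow> real ^ 'k" and B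
  where "\<And>x. \<bar>g x - f x\<bar> \<le> 1" "\<And>x. GDERIV g x :> p x" "\<And>x. norm (p x) \<le> 1"
    "\<And>i x. GDERIV (\<lambda>x. p x $ i) x :> H i x" "\<And>i. continuous_on UNIV (H i)" "\<And>i x. norm (H i x) \<le> B"
proof -
  have cf: "continuous_on UNIV f" by (rule lipschitz_imp_continuous_on[OF f])
  define c where "c = (\<integral>u. bump 3 (u :: real ^ 'k) \<partial>lborel)"
  have c: "c > 0" unfolding c_def by (rule integral_bump_pos) simp
  define \<kappa> :: "real ^ 'k \<Rightarrow> real" where "\<kappa> u = inverse c * bump 3 u" for u
  define V :: "real ^ 'k \<Rightarrow> real ^ 'k" where "V u = (inverse c * 6 * bump 2 u) *\<^sub>R u" for u
  define W :: "'k \<Rightarrow> real ^ 'k \<Rightarrow> real ^ 'k" where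
    "W i u = (inverse c * 6) *\<^sub>R (bump 2 u *\<^sub>R axis i 1 - (4 * bump 1 u * u $ i) *\<^sub>R u)" for i u
  have d\<kappa>: "GDERIV \<kappa> u :> - V u" for u
    using GDERIV_mult[OF GDERIV_const[of "inverse c" u] GDERIV_bump[of 1 u]]
    unfolding \<kappa>_def V_def by (simp add: eval_nat_numeral mult.assoc)
  have dV: "GDERIV (\<lambda>u. V u $ i) u :> W i u" for i u
  proof -
    have "GDERIV (\<lambda>u. bump 2 u) u :> (- 4 * bump 1 u) *\<^sub>R u"
      using GDERIV_bump[of 0 u] by (simp add: eval_nat_numeral)
    from GDERIV_mult[OF GDERIV_const[of "inverse c * 6" u] GDERIV_mult[OF this GDERIV_vec_nth[of i u]]]
    have "GDERIV (\<lambda>u. inverse c * 6 * (bump 2 u * u $ i)) u :> W i u"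
      by (rule GDERIV_subst) (simp add: W_def)
    moreover have "(\<lambda>u. V u $ i) = (\<lambda>u. inverse c * 6 * (bump 2 u * u $ i))"
      by (simp add: V_def fun_eq_iff mult.assoc)
    ultimately show ?thesis by simp
  qed
  have cont: "continuous_on UNIV \<kappa>" "continuous_on UNIV V" "continuous_on UNIV (W i)" for i
    unfolding \<kappa>_def V_def W_def by (auto intro!: continuous_intros continuous_bump)
  have supp: "\<kappa> u = 0" "V u = 0" "W i u = 0" if "u \<notin> cball 0 1" for i u
    using bump_eq_0[OF that] unfolding \<kappa>_def V_def W_def by simp_all
  define g where "g x = (\<integral>u. f (x + u) * \<kappa> u \<partial>lborel)" for x
  define p where "p x = (\<integral>u. f (x + u) *\<^sub>R V u \<partial>lborel)" for x
  define H where "H i x = (\<integral>u. f (x + u) *\<^sub>R (- W i u) \<partial>lborel)" for i x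
  have \<kappa>0: "\<kappa> u \<ge> 0" for u using c bump_nonneg[of 3 u] by (simp add: \<kappa>_def)
  have \<kappa>1: "(\<integral>u. \<kappa> u \<partial>lborel) = 1"
    using c unfolding \<kappa>_def by (simp add: c_def)
  have I\<kappa>: "integrable lborel \<kappa>"
    using integrable_continuous_times_compact_support[of "\<lambda>_. 1" \<kappa>] cont supp by simp
  have dg: "GDERIV g x :> p x" for x
    using smoothing_GDERIV[OF cf d\<kappa>, of x] cont supp
    unfolding g_def p_def by (simp add: continuous_on_minus)
  have p_nth: "p x $ i = (\<integral>u. f (x + u) * V u $ i \<partial>lborel)" for x i
    unfolding p_def using integral_bounded_linear[OF bounded_linear_vec_nth[of i] integrable_continuous_times_compact_support[OF cf cont(2) supp(2)], of x]
    by simp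
  have dp: "GDERIV (\<lambda>x. p x $ i) x :> H i x" for i x
    unfolding p_nth H_def
    by (rule smoothing_GDERIV[OF cf dV]) (auto simp: supp cont)
  have g_lip: "\<bar>g x - g y\<bar> \<le> norm (x - y)" for x y
    using smoothing_lipschitz[OF f cont(1) supp(1), of x y] \<kappa>0 \<kappa>1 unfolding g_def by simp
  have p1: "norm (p x) \<le> 1" for x
    by (rule norm_gradient_le[OF dg, of 1]) (use g_lip in auto)
  define B where "B i = (\<integral>u. norm (V u $ i) \<partial>lborel)" for i
  have HB: "norm (H i x) \<le> B i" for i x
  proof (rule norm_gradient_le[OF dp, of 1])
    fix y
    show "\<bar>p y $ i - p x $ i\<bar> \<le> B i * norm (y - x)"
      using smoothing_lipschitz[of f "\<lambda>u. V u $ i" y x, OF f] cont(2) supp(2)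
      unfolding p_nth B_def by (auto intro!: continuous_intros)
  qed (auto simp: B_def)
  have HB': "norm (H i x) \<le> Max (range B)" for i x
    using HB[of i x] by (meson Max_ge finite finite_imageI order_trans rangeI)
  have cH: "continuous_on UNIV (H i)" for i
  proof (rule lipschitz_on_continuous_on[OF lipschitz_onI])
    fix x y show "dist (H i x) (H i y) \<le> (\<integral>u. norm (- W i u) \<partial>lborel) * dist x y"
      unfolding H_def dist_norm
      by (rule smoothing_lipschitz[OF f]) (auto simp: supp cont intro!: continuous_intros)
  qed simp
  have gf: "\<bar>g x - f x\<bar> \<le> 1" for x
  proof -
    have I: "integrable lborel (\<lambda>u. f (x + u) * \<kappa> u)"
      using integrable_continuous_times_compact_support[OF cf cont(1) supp(1)] by simp
    have "g x - f x = (\<integral>u. f (x + u) * \<kappa> u - f x * \<kappa> u \<partial>lborel)"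
      using I I\<kappa> \<kappa>1 by (simp add: g_def)
    also have "norm \<dots> \<le> (\<integral>u. \<kappa> u \<partial>lborel)"
    proof (rule Bochner_Integration.integral_norm_bound_integral)
      fix u
      show "norm (f (x + u) * \<kappa> u - f x * \<kappa> u) \<le> \<kappa> u"
      proof (cases "u \<in> cball 0 1")
        case True
        have "\<bar>f (x + u) - f x\<bar> * \<kappa> u \<le> 1 * \<kappa> u"
          using f[of "x + u" x] True \<kappa>0 by (intro mult_right_mono) auto
        then show ?thesis using \<kappa>0[of u] by (simp add: abs_mult flip: left_diff_distrib)
      qed (simp add: supp)
    qed (use I I\<kappa> in auto)
    finally show ?thesis using \<kappa>1 by simp
  qed
  show thesis by (rule that[OF gf dg p1 dp cH HB'])
qed

text \<open>
The approximation within 1, applied to \<open>f (\<epsilon> x) / \<epsilon>\<close> and scaled back: this keeps the Lipschitz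
constant, multiplies the error by \<open>\<epsilon>\<close> and divides the bound on the Hessian by \<open>\<epsilon>\<close>.
\<close>

lemma smooth_approximation:
  fixes f :: "real ^ 'k \<Rightarrow> real"
  assumes f: "\<And>x y. \<bar>f x - f y\<bar> \<le> norm (x - y)" and "\<epsilon> > 0"
  obtains g :: "real ^ 'k \<Rightarrow> real" and p :: "real ^ 'k \<Rightarrow> real ^ 'k" and H :: "'k \<Rightarrow> real ^ 'k \<Rightarrow> real ^ 'k" and B
  where "\<And>x. \<bar>g x - f x\<bar> \<le> \<epsilon>" "\<And>x. GDERIV g x :> p x" "\<And>x. norm (p x) \<le> 1"
    "\<And>i x. GDERIV (\<lambda>x. p x $ i) x :> H i x" "\<And>i. continuous_on UNIV (H i)" "\<And>i x. norm (H i x) \<le> B"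
proof -
  have "\<bar>f (\<epsilon> *\<^sub>R x) / \<epsilon> - f (\<epsilon> *\<^sub>R y) / \<epsilon>\<bar> \<le> norm (x - y)" for x y
  proof -
    have "f (\<epsilon> *\<^sub>R x) / \<epsilon> - f (\<epsilon> *\<^sub>R y) / \<epsilon> = (f (\<epsilon> *\<^sub>R x) - f (\<epsilon> *\<^sub>R y)) / \<epsilon>"
      by (simp add: diff_divide_distrib)
    moreover have "norm (\<epsilon> *\<^sub>R x - \<epsilon> *\<^sub>R y) = \<epsilon> * norm (x - y)"
      using \<open>\<epsilon> > 0\<close> by (simp flip: scaleR_right_diff_distrib)
    ultimately show ?thesis
      using f[of "\<epsilon> *\<^sub>R x" "\<epsilon> *\<^sub>R y"] \<open>\<epsilon> > 0\<close> by (simp add: divide_le_eq mult.commute)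
  qed
  then obtain g :: "real ^ 'k \<Rightarrow> real" and p :: "real ^ 'k \<Rightarrow> real ^ 'k" and H :: "'k \<Rightarrow> real ^ 'k \<Rightarrow> real ^ 'k" and B
    where *: "\<And>x. \<bar>g x - f (\<epsilon> *\<^sub>R x) / \<epsilon>\<bar> \<le> 1" "\<And>x. GDERIV g x :> p x" "\<And>x. norm (p x) \<le> 1"
    "\<And>i x. GDERIV (\<lambda>x. p x $ i) x :> H i x" "\<And>i. continuous_on UNIV (H i)" "\<And>i x. norm (H i x) \<le> B"
    by (rule smooth_approximation_within_1) (rule that)
  have scale: "GDERIV (\<lambda>x. h (x /\<^sub>R \<epsilon>)) x :> D /\<^sub>R \<epsilon>" if "GDERIV h (x /\<^sub>R \<epsilon>) :> D" for h x and D :: "real ^ 'k"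
  proof -
    have "((\<lambda>x. x /\<^sub>R \<epsilon>) has_derivative (\<lambda>h. h /\<^sub>R \<epsilon>)) (at x)" by (auto intro!: derivative_eq_intros)
    from has_derivative_compose[OF this that[unfolded gderiv_def]] show ?thesis
      by (simp add: gderiv_def)
  qed
  show thesis
  proof (rule that[of "\<lambda>x. \<epsilon> * g (x /\<^sub>R \<epsilon>)" "\<lambda>x. p (x /\<^sub>R \<epsilon>)" "\<lambda>i x. H i (x /\<^sub>R \<epsilon>) /\<^sub>R \<epsilon>" "B / \<epsilon>"])
    fix x i
    show "\<bar>\<epsilon> * g (x /\<^sub>R \<epsilon>) - f x\<bar> \<le> \<epsilon>"
    proof -
      have "\<bar>\<epsilon> * g (x /\<^sub>R \<epsilon>) - f x\<bar> = \<epsilon> * \<bar>g (x /\<^sub>R \<epsilon>) - f (\<epsilon> *\<^sub>R (x /\<^sub>R \<epsilon>)) / \<epsilon>\<bar>"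
        using \<open>\<epsilon> > 0\<close> by (simp add: abs_mult_pos' right_diff_distrib)
      also have "\<dots> \<le> \<epsilon>" using *(1)[of "x /\<^sub>R \<epsilon>"] \<open>\<epsilon> > 0\<close> by simp
      finally show ?thesis .
    qed
    show "GDERIV (\<lambda>x. \<epsilon> * g (x /\<^sub>R \<epsilon>)) x :> p (x /\<^sub>R \<epsilon>)"
      using GDERIV_mult[OF GDERIV_const[of \<epsilon> x] scale[OF *(2)]] \<open>\<epsilon> > 0\<close> by simp
    show "norm (H i (x /\<^sub>R \<epsilon>) /\<^sub>R \<epsilon>) \<le> B / \<epsilon>"
      using *(6)[of i "x /\<^sub>R \<epsilon>"] \<open>\<epsilon> > 0\<close> by (simp add: divide_inverse mult.commute mult_right_mono)
    show "GDERIV (\<lambda>x. p (x /\<^sub>R \<epsilon>) $ i) x :> H i (x /\<^sub>R \<epsilon>) /\<^sub>R \<epsilon>"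
      by (rule scale[OF *(4)])
    show "continuous_on UNIV (\<lambda>x. H i (x /\<^sub>R \<epsilon>) /\<^sub>R \<epsilon>)"
      by (intro continuous_intros continuous_on_compose2[OF *(5)]) auto
  qed (use * in auto)
qed

section \<open>Integration by parts for the Haar measure\<close>

lemma borel_measurable_pair_stiefel:
  fixes F :: "(real ^ 'd) \<times> (real ^ 'd ^ 'k) \<Rightarrow> real"
  assumes "F \<in> borel_measurable borel"
  shows "F \<in> borel_measurable (borel \<Otimes>\<^sub>M borel_stiefel)"
proof -
  let ?S = "borel_stiefel :: (real ^ 'd ^ 'k) measure"
  have 1: "(\<lambda>x. x) \<in> measurable ?S (borel :: (real ^ 'd ^ 'k) measure)"
    by (rule measurable_restrict_space1) simp
  have 2: "(\<lambda>z. snd z) \<in> measurable ((borel :: (real ^ 'd) measure) \<Otimes>\<^sub>M ?S) (borel :: (real ^ 'd ^ 'k) measure)"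
    by (rule measurable_compose[OF measurable_snd 1])
  have 3: "(\<lambda>z. (fst z, snd z)) \<in> measurable ((borel :: (real ^ 'd) measure) \<Otimes>\<^sub>M ?S) (borel \<Otimes>\<^sub>M (borel :: (real ^ 'd ^ 'k) measure))"
    by (rule measurable_Pair[OF measurable_fst 2])
  have "F \<in> borel_measurable (borel \<Otimes>\<^sub>M (borel :: (real ^ 'd ^ 'k) measure))" using assms by (simp add: borel_prod)
  from measurable_compose[OF 3 this] show ?thesis by simp
qed

locale random_projection = prob_space M for M :: "'a measure" +
  fixes X :: "'a \<Rightarrow> real ^ 'd" and \<theta> :: "'a \<Rightarrow> real ^ 'd ^ 'k"
  assumes X_measurable[measurable]: "X \<in> borel_measurable M"
    and X_square_integrable: "integrable M (\<lambda>\<omega>. (norm (X \<omega>))\<^sup>2)"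
    and frame_measurable[measurable]: "\<theta> \<in> measurable M borel_stiefel"
    and frame_haar: "stiefel_haar (distr M borel_stiefel \<theta>)"
    and indep: "indep_pair borel X borel_stiefel \<theta>"
begin

lemma frame_borel[measurable]: "\<theta> \<in> borel_measurable M"
  using frame_measurable by (rule measurable_restrict_space2_iff[THEN iffD1, THEN conjunct1])

lemma frame_in_stiefel: "\<omega> \<in> space M \<Longrightarrow> \<theta> \<omega> \<in> stiefel"
  using measurable_space[OF frame_measurable] by (simp add: space_restrict_space)

text \<open>
A measurable image of \<open>\<theta>\<close> is again independent of \<open>X\<close>, so that the joint law is a product measure.
Rotation invariance of the Haar measure then concerns one factor of this product.
\<close>

lemma distr_pair_transformed_frame:
  assumes [measurable]: "R \<in> measurable borel_stiefel borel_stiefel"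
  shows "distr M (borel \<Otimes>\<^sub>M borel_stiefel) (\<lambda>\<omega>. (X \<omega>, R (\<theta> \<omega>)))
    = distr M borel X \<Otimes>\<^sub>M distr (distr M borel_stiefel \<theta>) borel_stiefel R"
proof (rule pair_measure_eqI[symmetric])
  interpret X: prob_space "distr M borel X" by (rule prob_space_distr) simp
  show "sigma_finite_measure (distr M borel X)" ..
  have "prob_space (distr (distr M borel_stiefel \<theta>) borel_stiefel R)"
    by (intro prob_space.prob_space_distr prob_space_distr) simp_all
  then interpret T: prob_space "distr (distr M borel_stiefel \<theta>) borel_stiefel R" .
  show "sigma_finite_measure (distr (distr M borel_stiefel \<theta>) borel_stiefel R)" ..
  fix A B assume "A \<in> sets (distr M borel X)" "B \<in> sets (distr (distr M borel_stiefel \<theta>) borel_stiefel R)"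
  then have [measurable]: "A \<in> sets borel" "B \<in> sets borel_stiefel" by simp_all
  let ?B = "R -` B \<inter> space borel_stiefel"
  have B'[measurable]: "?B \<in> sets borel_stiefel" by measurable
  have sets: "X -` A \<inter> space M \<in> sets M" "\<theta> -` ?B \<inter> space M \<in> sets M" by measurable
  have "prob ((X -` A \<inter> space M) \<inter> (\<theta> -` ?B \<inter> space M)) = prob (X -` A \<inter> space M) * prob (\<theta> -` ?B \<inter> space M)"
    using indep unfolding indep_pair_def
    by (elim conjE indep_setD, intro CollectI exI[of _ A] exI[of _ ?B] conjI refl)
      (simp, intro CollectI exI[of _ ?B] conjI refl B')
  moreover have "(\<lambda>\<omega>. (X \<omega>, R (\<theta> \<omega>))) -` (A \<times> B) \<inter> space M = (X -` A \<inter> space M) \<inter> (\<theta> -` ?B \<inter> space M)"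
    using measurable_space[OF frame_measurable] by auto
  ultimately show "emeasure (distr M borel X) A * emeasure (distr (distr M borel_stiefel \<theta>) borel_stiefel R) B
      = emeasure (distr M (borel \<Otimes>\<^sub>M borel_stiefel) (\<lambda>\<omega>. (X \<omega>, R (\<theta> \<omega>)))) (A \<times> B)"
    by (simp add: emeasure_distr emeasure_eq_measure ennreal_mult)
qed simp

text \<open>
The pairs \<open>(X, \<theta>)\<close> and \<open>(X, f \<theta>)\<close> have the same law, the product of the law of \<open>X\<close> and the Haar
measure.
\<close>

lemma expectation_rotation_invariant:
  fixes F :: "real ^ 'd \<Rightarrow> real ^ 'd ^ 'k \<Rightarrow> real"
  assumes f: "orthogonal_transformation f"
    and F: "case_prod F \<in> borel_measurable borel"
  shows "(\<integral>\<omega>. F (X \<omega>) (\<chi> i. f (\<theta> \<omega> $ i)) \<partial>M) = (\<integral>\<omega>. F (X \<omega>) (\<theta> \<omega>) \<partial>M)"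
proof -
  define R where "R t = (\<chi> i. f (t $ i))" for t :: "real ^ 'd ^ 'k"
  have "linear f" using f by (rule orthogonal_transformation_linear)
  have "continuous_on UNIV R"
    unfolding R_def by (intro continuous_intros linear_continuous_on_compose[OF _ \<open>linear f\<close>])
  then have "R \<in> borel_measurable borel" by (rule borel_measurable_continuous_onI)
  moreover have "R t \<in> stiefel" if "t \<in> stiefel" for t
    using that f by (simp add: R_def stiefel_def orthogonal_transformation_def)
  ultimately have R[measurable]: "R \<in> measurable borel_stiefel borel_stiefel"
    by (intro measurable_restrict_space2 measurable_restrict_space1) (auto simp: space_restrict_space)
  have [measurable]: "case_prod F \<in> borel_measurable (borel \<Otimes>\<^sub>M borel_stiefel)"
    by (rule borel_measurable_pair_stiefel[OF F])
  have "distr (distr M borel_stiefel \<theta>) borel_stiefel R = distr M borel_stiefel \<theta>"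
  proof -
    have "distr (distr M borel_stiefel \<theta>) (distr M borel_stiefel \<theta>) R = distr M borel_stiefel \<theta>"
      using frame_haar f unfolding stiefel_haar_def R_def by blast
    moreover have "distr (distr M borel_stiefel \<theta>) borel_stiefel R = distr (distr M borel_stiefel \<theta>) (distr M borel_stiefel \<theta>) R"
      by (rule distr_cong) auto
    ultimately show ?thesis by simp
  qed
  moreover have "distr (distr M borel_stiefel \<theta>) borel_stiefel (\<lambda>t. t) = distr M borel_stiefel \<theta>"
    by (simp add: distr_distr comp_def)
  ultimately have "distr M (borel \<Otimes>\<^sub>M borel_stiefel) (\<lambda>\<omega>. (X \<omega>, R (\<theta> \<omega>)))
      = distr M (borel \<Otimes>\<^sub>M borel_stiefel) (\<lambda>\<omega>. (X \<omega>, \<theta> \<omega>))"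
    using distr_pair_transformed_frame[OF R] distr_pair_transformed_frame[of "\<lambda>t. t"] by simp
  then have "(\<integral>z. case_prod F z \<partial>distr M (borel \<Otimes>\<^sub>M borel_stiefel) (\<lambda>\<omega>. (X \<omega>, R (\<theta> \<omega>))))
      = (\<integral>z. case_prod F z \<partial>distr M (borel \<Otimes>\<^sub>M borel_stiefel) (\<lambda>\<omega>. (X \<omega>, \<theta> \<omega>)))" by simp
  moreover have "(\<lambda>\<omega>. (X \<omega>, R (\<theta> \<omega>))) \<in> measurable M (borel \<Otimes>\<^sub>M borel_stiefel)"
    "(\<lambda>\<omega>. (X \<omega>, \<theta> \<omega>)) \<in> measurable M (borel \<Otimes>\<^sub>M borel_stiefel)" by measurable
  ultimately show ?thesis
    using integral_distr[of _ M "borel \<Otimes>\<^sub>M borel_stiefel" "case_prod F"] by (simp add: R_def)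
qed

end

definition coords_in_frame :: "real ^ 'd \<Rightarrow> real ^ 'd ^ 'k \<Rightarrow> real ^ 'k" where
  "coords_in_frame x t = (\<chi> i. x \<bullet> t $ i)"

text \<open>
For \<open>a \<noteq> b\<close>, the rotation by the angle \<open>s\<close> in the plane of the coordinates \<open>a\<close> and \<open>b\<close>.
\<close>

definition plane_rotation :: "'d \<Rightarrow> 'd \<Rightarrow> real \<Rightarrow> real ^ 'd \<Rightarrow> real ^ 'd" where
  "plane_rotation a b s x = x + (cos s - 1) *\<^sub>R (x $ a *\<^sub>R axis a 1 + x $ b *\<^sub>R axis b 1)
     + sin s *\<^sub>R (x $ a *\<^sub>R axis b 1 - x $ b *\<^sub>R axis a 1)"

text \<open>
The derivative at angle 0 of the coordinates of \<open>x\<close> in the frame \<open>t\<close> when the frame is turned by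
\<open>plane_rotation a b\<close>.
\<close>

definition rotation_velocity :: "'d \<Rightarrow> 'd \<Rightarrow> real ^ 'd \<Rightarrow> real ^ 'd ^ 'k \<Rightarrow> real ^ 'k" where
  "rotation_velocity a b x t = (\<chi> i. x $ b * t $ i $ a - x $ a * t $ i $ b)"

text \<open>
The contribution of the coordinates \<open>a\<close> and \<open>b\<close> to the coordinates of \<open>x\<close> in the frame \<open>t\<close>. Its
negative is the second derivative at angle 0 of these coordinates under the rotation.
\<close>

definition plane_part :: "'d \<Rightarrow> 'd \<Rightarrow> real ^ 'd \<Rightarrow> real ^ 'd ^ 'k \<Rightarrow> real ^ 'k" where
  "plane_part a b x t = (\<chi> i. x $ a * t $ i $ a + x $ b * t $ i $ b)"

lemma orthogonal_plane_rotation: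
  assumes "a \<noteq> b"
  shows "orthogonal_transformation (plane_rotation a b s)"
  unfolding orthogonal_transformation_def
proof (intro conjI allI)
  show "linear (plane_rotation a b s)"
    by (rule linearI) (simp_all add: plane_rotation_def algebra_simps)
  fix v w :: "real ^ 'a"
  have ax: "axis a 1 $ b = (0::real)" "axis b 1 $ a = (0::real)" "axis a 1 $ a = (1::real)" "axis b 1 $ b = (1::real)"
    using assms by (auto simp: axis_def)
  have "plane_rotation a b s v \<bullet> plane_rotation a b s w
    = v \<bullet> w + ((cos s)\<^sup>2 + (sin s)\<^sup>2 - 1) * (v $ a * w $ a + v $ b * w $ b)"
    unfolding plane_rotation_def
    by (simp add: inner_add_left inner_add_right inner_diff_left inner_diff_right inner_axis inner_axis' ax
        power2_eq_square algebra_simps del: sin_cos_squared_add sin_cos_squared_add2 sin_cos_squared_add3)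
  then show "plane_rotation a b s v \<bullet> plane_rotation a b s w = v \<bullet> w" by simp
qed

lemma coords_rotated_frame:
  "coords_in_frame x (\<chi> i. plane_rotation a b s (t $ i))
    = coords_in_frame x t + (cos s - 1) *\<^sub>R plane_part a b x t + sin s *\<^sub>R rotation_velocity a b x t"
  by (simp add: vec_eq_iff coords_in_frame_def plane_rotation_def plane_part_def rotation_velocity_def
      inner_add_right inner_diff_right inner_axis algebra_simps)

lemma velocity_rotated_frame:
  assumes "a \<noteq> b"
  shows "rotation_velocity a b x (\<chi> i. plane_rotation a b s (t $ i))
    = cos s *\<^sub>R rotation_velocity a b x t - sin s *\<^sub>R plane_part a b x t"
  using assms
  by (auto simp: vec_eq_iff plane_rotation_def plane_part_def rotation_velocity_def axis_def algebra_simps)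

lemma norm_le_card_times:
  fixes v :: "real ^ 'k"
  assumes "\<And>i. \<bar>v $ i\<bar> \<le> c"
  shows "norm v \<le> real CARD('k) * c"
  using norm_le_l1_cart[of v] sum_bounded_above[of UNIV "\<lambda>i. \<bar>v $ i\<bar>" c] assms by simp

lemma norm_frame_vector: "t \<in> stiefel \<Longrightarrow> norm (t $ i) = 1"
  by (simp add: stiefel_def norm_eq_sqrt_inner)

lemma stiefel_bounds:
  fixes t :: "real ^ 'd ^ 'k"
  assumes t: "t \<in> stiefel"
  shows "norm (coords_in_frame x t) \<le> real CARD('k) * norm x"
    and "norm (rotation_velocity a b x t) \<le> real CARD('k) * (2 * norm x)"
    and "norm (plane_part a b x t) \<le> real CARD('k) * (2 * norm x)"
proof -
  have c: "\<bar>x $ a * t $ i $ b\<bar> \<le> norm x" for a b i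
    using mult_mono[OF component_le_norm_cart[of x a] component_le_norm_cart[of "t $ i" b]]
      norm_frame_vector[OF t, of i] by (simp add: abs_mult)
  have "\<bar>x \<bullet> t $ i\<bar> \<le> norm x" for i
    using Cauchy_Schwarz_ineq2[of x "t $ i"] norm_frame_vector[OF t, of i] by simp
  then show "norm (coords_in_frame x t) \<le> real CARD('k) * norm x"
    by (intro norm_le_card_times) (simp add: coords_in_frame_def)
  have "\<bar>x $ b * t $ i $ a - x $ a * t $ i $ b\<bar> \<le> 2 * norm x" for i
    using c[of b i a] c[of a i b] by linarith
  then show "norm (rotation_velocity a b x t) \<le> real CARD('k) * (2 * norm x)"
    by (intro norm_le_card_times) (simp add: rotation_velocity_def)
  have "\<bar>x $ a * t $ i $ a + x $ b * t $ i $ b\<bar> \<le> 2 * norm x" for i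
    using c[of a i a] c[of b i b] by linarith
  then show "norm (plane_part a b x t) \<le> real CARD('k) * (2 * norm x)"
    by (intro norm_le_card_times) (simp add: plane_part_def)
qed

lemma vector_field_lipschitz:
  fixes p :: "real ^ 'k \<Rightarrow> real ^ 'k"
  assumes "\<And>i x. GDERIV (\<lambda>x. p x $ i) x :> H i x" "\<And>i x. norm (H i x) \<le> B"
  shows "norm (p x - p y) \<le> real CARD('k) * B * norm (x - y)"
proof -
  have "\<bar>(p x - p y) $ i\<bar> \<le> B * norm (x - y)" for i
    using bounded_gradient_imp_lipschitz[OF assms] by simp
  from norm_le_card_times[OF this] show ?thesis by (simp add: mult.assoc)
qed

text \<open>
The Lagrange identity, in polarised form.
\<close>

lemma sum_velocity_products:
  fixes x s t :: "real ^ 'd"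
  shows "(\<Sum>a\<in>UNIV. \<Sum>b\<in>UNIV. (x $ b * s $ a - x $ a * s $ b) * (x $ b * t $ a - x $ a * t $ b))
    = 2 * ((x \<bullet> x) * (s \<bullet> t) - (x \<bullet> s) * (x \<bullet> t))"
proof -
  have sw: "(\<Sum>a\<in>UNIV. \<Sum>b\<in>UNIV. (f b * g a :: real)) = sum f UNIV * sum g UNIV" for f g :: "'d \<Rightarrow> real"
    unfolding sum_product by (rule sum.swap)
  have "(\<Sum>a\<in>UNIV. \<Sum>b\<in>UNIV. (x $ b * s $ a - x $ a * s $ b) * (x $ b * t $ a - x $ a * t $ b))
    = (\<Sum>a\<in>UNIV. \<Sum>b\<in>UNIV. (x $ b * x $ b) * (s $ a * t $ a) + (s $ b * t $ b) * (x $ a * x $ a)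
        - (x $ b * t $ b) * (x $ a * s $ a) - (x $ b * s $ b) * (x $ a * t $ a))"
    by (intro sum.cong refl) (simp add: algebra_simps)
  also have "\<dots> = 2 * ((x \<bullet> x) * (s \<bullet> t) - (x \<bullet> s) * (x \<bullet> t))"
    unfolding sum.distrib sum_subtractf sw by (simp add: inner_vec_def algebra_simps)
  finally show ?thesis .
qed

lemma sum_plane_part:
  fixes x :: "real ^ 'd" and t :: "real ^ 'd ^ 'k"
  shows "(\<Sum>a\<in>UNIV. \<Sum>b\<in>UNIV. if a = b then 0 else plane_part a b x t)
    = (2 * (real CARD('d) - 1)) *\<^sub>R coords_in_frame x t"
proof -
  have "(\<Sum>a\<in>UNIV. \<Sum>b\<in>UNIV. if a = b then 0 else plane_part a b x t)
     = (\<Sum>a\<in>UNIV. \<Sum>b\<in>UNIV. plane_part a b x t - (if a = b then plane_part a b x t else 0))"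
    by (intro sum.cong refl) auto
  also have "\<dots> = (\<Sum>a\<in>UNIV. \<Sum>b\<in>UNIV. plane_part a b x t) - (\<Sum>a\<in>UNIV. plane_part a a x t)"
    by (simp add: sum_subtractf)
  also have "\<dots> = (2 * (real CARD('d) - 1)) *\<^sub>R coords_in_frame x t"
    by (simp add: vec_eq_iff plane_part_def coords_in_frame_def inner_vec_def sum.distrib
        algebra_simps sum_distrib_left)
  finally show ?thesis .
qed

text \<open>
The integrand of \<open>plane_rotation_identity\<close> summed over all coordinate planes, each counted twice.
Orthonormality of the frame reduces the sum of \<open>V\<^sub>i V\<^sub>j\<close> to \<open>\<bar>x\<bar>\<^sup>2 \<delta>\<^sub>i\<^sub>j - w\<^sub>i w\<^sub>j\<close>, which no longer
mentions the frame.
\<close>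

lemma sum_rotation_generators:
  fixes x :: "real ^ 'd" and t :: "real ^ 'd ^ 'k" and p :: "real ^ 'k" and H :: "'k \<Rightarrow> real ^ 'k"
  assumes "t \<in> stiefel"
  defines "w \<equiv> coords_in_frame x t"
  shows "(\<Sum>a\<in>UNIV. \<Sum>b\<in>UNIV. if a = b then 0 else
      (\<Sum>i\<in>UNIV. rotation_velocity a b x t $ i * (rotation_velocity a b x t \<bullet> H i)) - p \<bullet> plane_part a b x t)
    = 2 * ((norm x)\<^sup>2 * (\<Sum>i\<in>UNIV. H i $ i) - (\<Sum>i\<in>UNIV. w $ i * (w \<bullet> H i)) - (real CARD('d) - 1) * (p \<bullet> w))"
proof -
  let ?V = "\<lambda>a b. rotation_velocity a b x t"
  have orth: "t $ i \<bullet> t $ j = (if i = j then 1 else 0)" for i j using assms(1) by (simp add: stiefel_def)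
  have V0: "?V a a = 0" for a by (simp add: rotation_velocity_def vec_eq_iff)
  have VV: "(\<Sum>a\<in>UNIV. \<Sum>b\<in>UNIV. ?V a b $ i * ?V a b $ j) = 2 * ((if i = j then (norm x)\<^sup>2 else 0) - w $ i * w $ j)" for i j
    using sum_velocity_products[of x "t $ i" "t $ j"]
    by (simp add: rotation_velocity_def orth w_def coords_in_frame_def power2_norm_eq_inner)
  have "(\<Sum>a\<in>UNIV. \<Sum>b\<in>UNIV. if a = b then 0 else (\<Sum>i\<in>UNIV. ?V a b $ i * (?V a b \<bullet> H i)) - p \<bullet> plane_part a b x t)
    = (\<Sum>a\<in>UNIV. \<Sum>b\<in>UNIV. (\<Sum>i\<in>UNIV. \<Sum>j\<in>UNIV. (?V a b $ i * ?V a b $ j) * H i $ j)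
         - p \<bullet> (if a = b then 0 else plane_part a b x t))"
    by (intro sum.cong refl) (auto simp: V0 inner_vec_def sum_distrib_left mult.assoc)
  also have "\<dots> = (\<Sum>a\<in>UNIV. \<Sum>b\<in>UNIV. \<Sum>i\<in>UNIV. \<Sum>j\<in>UNIV. (?V a b $ i * ?V a b $ j) * H i $ j)
      - p \<bullet> (\<Sum>a\<in>UNIV. \<Sum>b\<in>UNIV. if a = b then 0 else plane_part a b x t)"
    by (simp add: sum_subtractf inner_sum_right)
  also have "(\<Sum>a\<in>UNIV. \<Sum>b\<in>UNIV. \<Sum>i\<in>UNIV. \<Sum>j\<in>UNIV. (?V a b $ i * ?V a b $ j) * H i $ j)
     = (\<Sum>i\<in>UNIV. \<Sum>j\<in>UNIV. (\<Sum>a\<in>UNIV. \<Sum>b\<in>UNIV. ?V a b $ i * ?V a b $ j) * H i $ j)"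
  proof -
    have "(\<Sum>a\<in>UNIV. \<Sum>b\<in>UNIV. \<Sum>i\<in>UNIV. \<Sum>j\<in>UNIV. f a b i j)
      = (\<Sum>i\<in>UNIV. \<Sum>j\<in>UNIV. \<Sum>a\<in>UNIV. \<Sum>b\<in>UNIV. f a b i j)" for f :: "'d \<Rightarrow> 'd \<Rightarrow> 'k \<Rightarrow> 'k \<Rightarrow> real"
    proof -
      have "(\<Sum>a\<in>UNIV. \<Sum>b\<in>UNIV. \<Sum>i\<in>UNIV. \<Sum>j\<in>UNIV. f a b i j) = (\<Sum>a\<in>UNIV. \<Sum>i\<in>UNIV. \<Sum>b\<in>UNIV. \<Sum>j\<in>UNIV. f a b i j)"
        by (rule sum.cong[OF refl sum.swap])
      also have "\<dots> = (\<Sum>i\<in>UNIV. \<Sum>a\<in>UNIV. \<Sum>b\<in>UNIV. \<Sum>j\<in>UNIV. f a b i j)"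
        by (rule sum.swap)
      also have "\<dots> = (\<Sum>i\<in>UNIV. \<Sum>a\<in>UNIV. \<Sum>j\<in>UNIV. \<Sum>b\<in>UNIV. f a b i j)"
        by (rule sum.cong[OF refl sum.cong[OF refl sum.swap]])
      also have "\<dots> = (\<Sum>i\<in>UNIV. \<Sum>j\<in>UNIV. \<Sum>a\<in>UNIV. \<Sum>b\<in>UNIV. f a b i j)"
        by (rule sum.cong[OF refl sum.swap])
      finally show ?thesis .
    qed
    then show ?thesis by (simp only: sum_distrib_right)
  qed
  also have "\<dots> = 2 * ((norm x)\<^sup>2 * (\<Sum>i\<in>UNIV. H i $ i) - (\<Sum>i\<in>UNIV. w $ i * (w \<bullet> H i)))"
  proof -
    have "(\<Sum>j\<in>UNIV. 2 * ((if i = j then (norm x)\<^sup>2 else 0) - w $ i * w $ j) * H i $ j)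
       = 2 * ((norm x)\<^sup>2 * H i $ i - w $ i * (w \<bullet> H i))" for i
    proof -
      have "(\<Sum>j\<in>UNIV. 2 * ((if i = j then (norm x)\<^sup>2 else 0) - w $ i * w $ j) * H i $ j)
         = (\<Sum>j\<in>UNIV. (if i = j then 2 * ((norm x)\<^sup>2 * H i $ j) else 0) - 2 * (w $ i * (w $ j * H i $ j)))"
        by (intro sum.cong refl) (auto simp: algebra_simps)
      then show ?thesis
        by (simp add: sum_subtractf inner_vec_def sum_distrib_left right_diff_distrib)
    qed
    then show ?thesis unfolding VV by (simp add: sum_subtractf sum_distrib_left right_diff_distrib)
  qed
  finally show ?thesis by (simp add: sum_plane_part w_def right_diff_distrib mult.assoc)
qed

context random_projection
begin

lemma norm_X_integrable: "integrable M (\<lambda>\<omega>. norm (X \<omega>))"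
  by (rule square_integrable_imp_integrable) (use X_square_integrable in simp_all)

text \<open>
The expectation of \<open>p(W) \<bullet> V\<close>, where \<open>V\<close> is the angular velocity of \<open>W\<close>, does not change when the
frame is rotated, and \<open>D\<close> is its derivative in the angle, at angle 0. Since \<open>p\<close> is Lipschitz, its growth is at
most linear, and everything is dominated by a polynomial of degree two in \<open>\<bar>X\<bar>\<close>.
\<close>

lemma plane_rotation_identity:
  fixes p :: "real ^ 'k \<Rightarrow> real ^ 'k"
  assumes p: "\<And>i x. GDERIV (\<lambda>x. p x $ i) x :> H i x" "\<And>i. continuous_on UNIV (H i)" "\<And>i x. norm (H i x) \<le> B"
    and "a \<noteq> b"
  defines "W \<equiv> \<lambda>\<omega>. coords_in_frame (X \<omega>) (\<theta> \<omega>)"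
    and "V \<equiv> \<lambda>\<omega>. rotation_velocity a b (X \<omega>) (\<theta> \<omega>)"
    and "U \<equiv> \<lambda>\<omega>. plane_part a b (X \<omega>) (\<theta> \<omega>)"
  defines "D \<equiv> \<lambda>\<omega>. (\<Sum>i\<in>UNIV. V \<omega> $ i * (V \<omega> \<bullet> H i (W \<omega>))) - p (W \<omega>) \<bullet> U \<omega>"
  shows "integrable M D" and "(\<integral>\<omega>. D \<omega> \<partial>M) = 0"
proof -
  define K where "K = real CARD('k)"
  define L where "L = K * B"
  define P where "P = norm (p 0)"
  have "0 \<le> B" using p(3) norm_ge_zero order_trans by blast
  then have nn: "K \<ge> 0" "L \<ge> 0" "P \<ge> 0" by (auto simp: K_def L_def P_def)
  have p_lip: "norm (p x - p y) \<le> L * norm (x - y)" for x y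
    unfolding L_def K_def by (rule vector_field_lipschitz[OF p(1,3)])
  have cp: "continuous_on UNIV p"
    by (rule lipschitz_on_continuous_on[OF lipschitz_onI, of _ _ L]) (use p_lip nn in \<open>auto simp: dist_norm\<close>)
  have [measurable]: "H i \<in> borel_measurable borel" "p \<in> borel_measurable borel" for i
    using p(2) cp by (auto intro: borel_measurable_continuous_onI)
  have [measurable]: "W \<in> borel_measurable M" "V \<in> borel_measurable M" "U \<in> borel_measurable M"
    unfolding W_def V_def U_def coords_in_frame_def rotation_velocity_def plane_part_def
    by (rule borel_measurable_vecI, simp only: vec_lambda_beta, measurable)+
  define F where "F x t = p (coords_in_frame x t) \<bullet> rotation_velocity a b x t" for x and t :: "real ^ 'd ^ 'k"
  have "continuous_on UNIV (case_prod F)"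
    unfolding F_def case_prod_beta coords_in_frame_def rotation_velocity_def
    by (intro continuous_intros continuous_on_compose2[OF cp] subset_UNIV)
  then have Fm: "case_prod F \<in> borel_measurable borel" by (rule borel_measurable_continuous_onI)
  define \<gamma> where "\<gamma> \<omega> s = W \<omega> + (cos s - 1) *\<^sub>R U \<omega> + sin s *\<^sub>R V \<omega>" for \<omega> s
  define e where "e \<omega> s = cos s *\<^sub>R V \<omega> - sin s *\<^sub>R U \<omega>" for \<omega> s
  define \<phi> where "\<phi> s \<omega> = p (\<gamma> \<omega> s) \<bullet> e \<omega> s" for s \<omega>
  \<comment> \<open>\<open>\<gamma>\<close> and \<open>e\<close> are the projection and its velocity for the frame rotated by \<open>s\<close>; note \<open>e = \<gamma>'\<close>.\<close>
  have \<phi>_eq: "\<phi> s \<omega> = F (X \<omega>) (\<chi> i. plane_rotation a b s (\<theta> \<omega> $ i))" for s \<omega>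
    unfolding \<phi>_def F_def coords_rotated_frame velocity_rotated_frame[OF \<open>a \<noteq> b\<close>] \<gamma>_def e_def W_def V_def U_def ..
  have const: "(\<integral>\<omega>. \<phi> s \<omega> \<partial>M) = (\<integral>\<omega>. F (X \<omega>) (\<theta> \<omega>) \<partial>M)" for s
    unfolding \<phi>_eq by (rule expectation_rotation_invariant[OF orthogonal_plane_rotation[OF \<open>a \<noteq> b\<close>] Fm])
  define r where "r \<omega> = norm (X \<omega>)" for \<omega>
  \<comment> \<open>The two summands dominate the change of the factor \<open>p\<close> and that of the factor \<open>e\<close> in the product
    \<open>p (\<gamma> s) \<bullet> e s\<close>, per unit of angle.\<close>
  define Q where "Q \<omega> = L * (4 * K * r \<omega>)\<^sup>2 + (P + L * (K * r \<omega>)) * (4 * K * r \<omega>)" for \<omega>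
  have r: "integrable M r" "integrable M (\<lambda>\<omega>. (r \<omega>)\<^sup>2)" "r \<omega> \<ge> 0" for \<omega>
    using norm_X_integrable X_square_integrable unfolding r_def by auto
  have Qi: "integrable M Q"
  proof -
    have "Q = (\<lambda>\<omega>. (L * (4 * K)\<^sup>2 + L * K * 4 * K) * (r \<omega>)\<^sup>2 + P * 4 * K * r \<omega>)"
      unfolding Q_def by (auto simp: fun_eq_iff power2_eq_square algebra_simps)
    then show ?thesis using r by simp
  qed
  have Q0: "0 \<le> Q \<omega>" for \<omega> using nn r(3) by (simp add: Q_def)
  have bounds: "norm (W \<omega>) \<le> K * r \<omega>" "norm (V \<omega>) + norm (U \<omega>) \<le> 4 * K * r \<omega>" if "\<omega> \<in> space M" for \<omega>
    using stiefel_bounds(1)[OF frame_in_stiefel[OF that], of "X \<omega>"]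
      stiefel_bounds(2,3)[OF frame_in_stiefel[OF that], of a b "X \<omega>"]
    unfolding W_def V_def U_def K_def r_def by auto
  have pW: "norm (p (W \<omega>)) \<le> P + L * (K * r \<omega>)" if "\<omega> \<in> space M" for \<omega>
    using p_lip[of "W \<omega>" 0] norm_triangle_ineq2[of "p (W \<omega>)" "p 0"] mult_left_mono[OF bounds(1)[OF that] nn(2)]
    unfolding P_def by simp
  have trig: "\<bar>cos s - 1\<bar> \<le> \<bar>s\<bar>" "\<bar>sin s\<bar> \<le> \<bar>s\<bar>" for s :: real
    using trig_lipschitz[of s 0] by simp_all
  have comb: "norm (x *\<^sub>R V \<omega> + y *\<^sub>R U \<omega>) \<le> c * (4 * K * r \<omega>)"
    if "\<bar>x\<bar> \<le> c" "\<bar>y\<bar> \<le> c" "\<omega> \<in> space M" for x y c \<omega>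
  proof -
    have "norm (x *\<^sub>R V \<omega> + y *\<^sub>R U \<omega>) \<le> \<bar>x\<bar> * norm (V \<omega>) + \<bar>y\<bar> * norm (U \<omega>)"
      using norm_triangle_ineq[of "x *\<^sub>R V \<omega>" "y *\<^sub>R U \<omega>"] by simp
    also have "\<dots> \<le> c * norm (V \<omega>) + c * norm (U \<omega>)"
      using that by (intro add_mono mult_right_mono) auto
    also have "\<dots> \<le> c * (4 * K * r \<omega>)"
      using mult_left_mono[OF bounds(2)[OF that(3)], of c] that(1) by (simp add: distrib_left)
    finally show ?thesis .
  qed
  have lip: "\<bar>\<phi> s \<omega> - \<phi> 0 \<omega>\<bar> \<le> Q \<omega> * \<bar>s\<bar>" if \<omega>: "\<omega> \<in> space M" for s \<omega>
  proof -
    have "\<phi> s \<omega> - \<phi> 0 \<omega> = (p (\<gamma> \<omega> s) - p (W \<omega>)) \<bullet> e \<omega> s + p (W \<omega>) \<bullet> (e \<omega> s - V \<omega>)"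
      by (simp add: \<phi>_def \<gamma>_def e_def inner_diff_left inner_diff_right algebra_simps)
    also have "\<bar>\<dots>\<bar> \<le> norm (p (\<gamma> \<omega> s) - p (W \<omega>)) * norm (e \<omega> s) + norm (p (W \<omega>)) * norm (e \<omega> s - V \<omega>)"
      by (intro order_trans[OF abs_triangle_ineq] add_mono Cauchy_Schwarz_ineq2)
    also have "\<dots> \<le> (L * (\<bar>s\<bar> * (4 * K * r \<omega>))) * (1 * (4 * K * r \<omega>)) + (P + L * (K * r \<omega>)) * (\<bar>s\<bar> * (4 * K * r \<omega>))"
    proof (intro add_mono mult_mono)
      have "norm (\<gamma> \<omega> s - W \<omega>) \<le> \<bar>s\<bar> * (4 * K * r \<omega>)"
        using comb[of "sin s" "\<bar>s\<bar>" "cos s - 1" \<omega>] trig \<omega> by (simp add: \<gamma>_def add.commute)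
      then show "norm (p (\<gamma> \<omega> s) - p (W \<omega>)) \<le> L * (\<bar>s\<bar> * (4 * K * r \<omega>))"
        using p_lip[of "\<gamma> \<omega> s" "W \<omega>"] nn mult_left_mono order_trans by blast
      show "norm (e \<omega> s) \<le> 1 * (4 * K * r \<omega>)"
        using comb[of "cos s" 1 "- sin s" \<omega>] \<omega> by (simp add: e_def)
      have "e \<omega> s - V \<omega> = (cos s - 1) *\<^sub>R V \<omega> + (- sin s) *\<^sub>R U \<omega>"
        by (simp add: e_def algebra_simps)
      then show "norm (e \<omega> s - V \<omega>) \<le> \<bar>s\<bar> * (4 * K * r \<omega>)"
        using comb[of "cos s - 1" "\<bar>s\<bar>" "- sin s" \<omega>] trig \<omega> by simp
    qed (use pW[OF \<omega>] nn r(3) in auto)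
    also have "\<dots> = Q \<omega> * \<bar>s\<bar>" by (simp add: Q_def power2_eq_square algebra_simps)
    finally show ?thesis .
  qed
  have \<phi>0: "\<bar>\<phi> 0 \<omega>\<bar> \<le> Q \<omega>" if \<omega>: "\<omega> \<in> space M" for \<omega>
  proof -
    have "\<bar>\<phi> 0 \<omega>\<bar> \<le> norm (p (W \<omega>)) * norm (V \<omega>)"
      using Cauchy_Schwarz_ineq2[of "p (W \<omega>)" "V \<omega>"] by (simp add: \<phi>_def \<gamma>_def e_def)
    also have "\<dots> \<le> (P + L * (K * r \<omega>)) * (4 * K * r \<omega>)"
    proof (rule mult_mono[OF pW[OF \<omega>]])
      show "norm (V \<omega>) \<le> 4 * K * r \<omega>" using bounds(2)[OF \<omega>] norm_ge_zero[of "U \<omega>"] by linarith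
    qed (use nn r(3) in auto)
    also have "\<dots> \<le> Q \<omega>" using nn by (simp add: Q_def)
    finally show ?thesis .
  qed
  have \<phi>i: "integrable M (\<phi> s)" for s
  proof (rule Bochner_Integration.integrable_bound)
    show "integrable M (\<lambda>\<omega>. Q \<omega> * (1 + \<bar>s\<bar>))" using Qi by simp
    show "\<phi> s \<in> borel_measurable M" unfolding \<phi>_def \<gamma>_def e_def by measurable
    show "AE \<omega> in M. norm (\<phi> s \<omega>) \<le> norm (Q \<omega> * (1 + \<bar>s\<bar>))"
    proof (rule AE_I2)
      fix \<omega> assume "\<omega> \<in> space M"
      from lip[OF this, of s] \<phi>0[OF this] Q0[of \<omega>]
      show "norm (\<phi> s \<omega>) \<le> norm (Q \<omega> * (1 + \<bar>s\<bar>))"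
        unfolding real_norm_def by (subst abs_of_nonneg[of "Q \<omega> * _"]) (auto simp: distrib_left)
    qed
  qed
  have deriv: "GDERIV (\<lambda>s. \<phi> s \<omega>) 0 :> D \<omega>" if "\<omega> \<in> space M" for \<omega>
  proof -
    have g: "(\<gamma> \<omega> has_vector_derivative V \<omega>) (at 0)"
      unfolding \<gamma>_def by (auto intro!: derivative_eq_intros simp: has_vector_derivative_def)
    have "((\<lambda>s. p (\<gamma> \<omega> s) $ i * e \<omega> s $ i) has_real_derivative V \<omega> $ i * (V \<omega> \<bullet> H i (W \<omega>)) - p (W \<omega>) $ i * U \<omega> $ i) (at 0)" for i
    proof -
      have 1: "((\<lambda>s. p (\<gamma> \<omega> s) $ i) has_real_derivative V \<omega> \<bullet> H i (W \<omega>)) (at 0)"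
        by (rule GDERIV_along_curve[OF _ g, of "\<lambda>x. p x $ i"]) (use p(1)[of i "W \<omega>"] in \<open>simp add: \<gamma>_def\<close>)
      have 2: "((\<lambda>s. e \<omega> s $ i) has_real_derivative - U \<omega> $ i) (at 0)"
        unfolding e_def by (auto intro!: derivative_eq_intros)
      show ?thesis
        by (rule DERIV_cong[OF DERIV_mult[OF 1 2]]) (simp add: \<gamma>_def e_def)
    qed
    then have "((\<lambda>s. \<Sum>i\<in>UNIV. p (\<gamma> \<omega> s) $ i * e \<omega> s $ i) has_real_derivative
        (\<Sum>i\<in>UNIV. V \<omega> $ i * (V \<omega> \<bullet> H i (W \<omega>)) - p (W \<omega>) $ i * U \<omega> $ i)) (at 0)"
      by (intro DERIV_sum)
    then show ?thesis by (simp add: \<phi>_def inner_vec_def D_def sum_subtractf)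
  qed
  have Dm: "D \<in> borel_measurable M" unfolding D_def by measurable
  note I = GDERIV_integral[of 1 0 M \<phi> D Q, OF _ \<phi>i deriv Dm Qi Q0]
  have lip': "\<bar>\<phi> s \<omega> - \<phi> 0 \<omega>\<bar> \<le> Q \<omega> * norm (s - 0)" if "\<omega> \<in> space M" for s \<omega>
    using lip[OF that, of s] by (simp only: diff_zero real_norm_def)
  show "integrable M D" by (rule I(1)[OF zero_less_one _ lip']; assumption)
  have "GDERIV (\<lambda>s. \<integral>\<omega>. \<phi> s \<omega> \<partial>M) 0 :> (\<integral>\<omega>. D \<omega> \<partial>M)"
    by (rule I(2)[OF zero_less_one _ lip']; assumption)
  moreover have "GDERIV (\<lambda>s::real. \<integral>\<omega>. \<phi> s \<omega> \<partial>M) 0 :> 0" unfolding const by (rule GDERIV_const)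
  ultimately show "(\<integral>\<omega>. D \<omega> \<partial>M) = 0" unfolding gderiv_deriv by (rule DERIV_unique)
qed

text \<open>
Integration by parts for the Haar measure. For fixed \<open>X\<close> and a gradient field \<open>p = \<nabla>f\<close>, \<open>E\<close> is
\<open>\<bar>X\<bar>\<^sup>2\<close> times the Laplacian, on the sphere of radius \<open>\<bar>X\<bar>\<close>, of \<open>f\<close> composed with the projection.
\<close>

lemma rotation_identity:
  fixes p :: "real ^ 'k \<Rightarrow> real ^ 'k"
  assumes p: "\<And>i x. GDERIV (\<lambda>x. p x $ i) x :> H i x" "\<And>i. continuous_on UNIV (H i)" "\<And>i x. norm (H i x) \<le> B"
  defines "W \<equiv> \<lambda>\<omega>. coords_in_frame (X \<omega>) (\<theta> \<omega>)"
  defines "E \<equiv> \<lambda>\<omega>. (norm (X \<omega>))\<^sup>2 * (\<Sum>i\<in>UNIV. H i (W \<omega>) $ i)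
      - (\<Sum>i\<in>UNIV. W \<omega> $ i * (W \<omega> \<bullet> H i (W \<omega>))) - (real CARD('d) - 1) * (p (W \<omega>) \<bullet> W \<omega>)"
  shows "integrable M E" and "(\<integral>\<omega>. E \<omega> \<partial>M) = 0"
proof -
  define V where "V a b \<omega> = rotation_velocity a b (X \<omega>) (\<theta> \<omega>)" for a b \<omega>
  define D where "D a b \<omega> = (if a = b then 0 else
    (\<Sum>i\<in>UNIV. V a b \<omega> $ i * (V a b \<omega> \<bullet> H i (W \<omega>))) - p (W \<omega>) \<bullet> plane_part a b (X \<omega>) (\<theta> \<omega>))" for a b \<omega>
  have D: "has_bochner_integral M (D a b) 0" for a b
  proof (cases "a = b")
    case True
    then show ?thesis by (simp add: D_def[abs_def] has_bochner_integral_zero)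
  next
    case False
    from plane_rotation_identity[OF p False] show ?thesis
      by (simp add: has_bochner_integral_iff D_def[abs_def] V_def W_def False)
  qed
  have "has_bochner_integral M (\<lambda>\<omega>. (1/2) * (\<Sum>a\<in>UNIV. \<Sum>b\<in>UNIV. D a b \<omega>)) ((1/2) * (\<Sum>a\<in>(UNIV::'d set). \<Sum>b\<in>(UNIV::'d set). 0))"
    by (intro has_bochner_integral_mult_right has_bochner_integral_sum D)
  moreover have "E \<omega> = (1/2) * (\<Sum>a\<in>UNIV. \<Sum>b\<in>UNIV. D a b \<omega>)" if "\<omega> \<in> space M" for \<omega>
    using sum_rotation_generators[OF frame_in_stiefel[OF that], of "X \<omega>" "\<lambda>i. H i (W \<omega>)" "p (W \<omega>)"]
    unfolding D_def E_def V_def W_def by simp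
  ultimately have "has_bochner_integral M E 0"
    by (subst has_bochner_integral_cong[OF refl _ refl]) auto
  then show "integrable M E" and "(\<integral>\<omega>. E \<omega> \<partial>M) = 0" by (auto simp: has_bochner_integral_iff)
qed

text \<open>
The rotation identity for the field \<open>p(w) = w\<close>, whose divergence is \<open>k\<close>.
\<close>

lemma second_moment_projection:
  defines "W \<equiv> \<lambda>\<omega>. coords_in_frame (X \<omega>) (\<theta> \<omega>)"
  shows "integrable M (\<lambda>\<omega>. (norm (W \<omega>))\<^sup>2)"
    and "real CARD('d) * (\<integral>\<omega>. (norm (W \<omega>))\<^sup>2 \<partial>M) = real CARD('k) * (\<integral>\<omega>. (norm (X \<omega>))\<^sup>2 \<partial>M)"
proof -
  note I = rotation_identity[of "\<lambda>x. x" "\<lambda>i x. axis i 1" 1, OF GDERIV_vec_nth continuous_on_const]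
  have E: "(norm x)\<^sup>2 * (\<Sum>i\<in>(UNIV::'k set). axis i (1::real) $ i) - (\<Sum>i\<in>UNIV. w $ i * (w \<bullet> axis i 1)) - (real CARD('d) - 1) * (w \<bullet> w)
     = real CARD('k) * (norm x)\<^sup>2 - real CARD('d) * (norm w)\<^sup>2" for x :: "real ^ 'd" and w :: "real ^ 'k"
    unfolding power2_norm_eq_inner by (simp add: inner_axis inner_vec_def[of w w] algebra_simps)
  have J: "integrable M (\<lambda>\<omega>. real CARD('k) * (norm (X \<omega>))\<^sup>2 - real CARD('d) * (norm (W \<omega>))\<^sup>2)"
    "(\<integral>\<omega>. real CARD('k) * (norm (X \<omega>))\<^sup>2 - real CARD('d) * (norm (W \<omega>))\<^sup>2 \<partial>M) = 0"
    using I[unfolded E] unfolding W_def by (simp_all only: norm_axis_1 order_refl)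
  have "integrable M (\<lambda>\<omega>. real CARD('k) * (norm (X \<omega>))\<^sup>2
      - (real CARD('k) * (norm (X \<omega>))\<^sup>2 - real CARD('d) * (norm (W \<omega>))\<^sup>2))"
    by (rule Bochner_Integration.integrable_diff[OF integrable_mult_right[OF X_square_integrable] J(1)])
  also have "(\<lambda>\<omega>. real CARD('k) * (norm (X \<omega>))\<^sup>2
      - (real CARD('k) * (norm (X \<omega>))\<^sup>2 - real CARD('d) * (norm (W \<omega>))\<^sup>2)) = (\<lambda>\<omega>. real CARD('d) * (norm (W \<omega>))\<^sup>2)"
    by auto
  finally show i: "integrable M (\<lambda>\<omega>. (norm (W \<omega>))\<^sup>2)" by simp
  show "real CARD('d) * (\<integral>\<omega>. (norm (W \<omega>))\<^sup>2 \<partial>M) = real CARD('k) * (\<integral>\<omega>. (norm (X \<omega>))\<^sup>2 \<partial>M)"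
    using J(2) Bochner_Integration.integral_diff[OF integrable_mult_right[OF X_square_integrable] integrable_mult_right[OF i],
        of "real CARD('k)" "real CARD('d)"] by (simp only: integral_mult_right_zero)
qed

end

section \<open>Gaussian integration by parts\<close>

text \<open>
Nonnegativity of the variance of \<open>\<bar>f\<bar>\<close>.
\<close>

lemma (in prob_space) abs_expectation_le_sqrt:
  fixes f :: "'a \<Rightarrow> real"
  assumes [measurable]: "f \<in> borel_measurable M" and i: "integrable M (\<lambda>x. (f x)\<^sup>2)"
    and "(\<integral>x. (f x)\<^sup>2 \<partial>M) \<le> c\<^sup>2" "c \<ge> 0"
  shows "integrable M f" "(\<integral>x. \<bar>f x\<bar> \<partial>M) \<le> c"
proof -
  show f: "integrable M f" by (rule square_integrable_imp_integrable) (use i in simp_all)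
  have "(expectation (\<lambda>x. \<bar>f x\<bar>))\<^sup>2 \<le> expectation (\<lambda>x. \<bar>f x\<bar>\<^sup>2)"
    using variance_positive[of "\<lambda>x. \<bar>f x\<bar>"] variance_eq[of "\<lambda>x. \<bar>f x\<bar>"] f i by simp
  then have "(expectation (\<lambda>x. \<bar>f x\<bar>))\<^sup>2 \<le> c\<^sup>2" using assms(3) by simp
  then show "(\<integral>x. \<bar>f x\<bar> \<partial>M) \<le> c" using \<open>c \<ge> 0\<close> by (rule power2_le_imp_le)
qed

lemma std_normal_density_tendsto_0:
  "(std_normal_density \<longlongrightarrow> 0) at_top" "(std_normal_density \<longlongrightarrow> 0) at_bot"
proof -
  have "filterlim (\<lambda>x::real. 1/2 * x\<^sup>2) at_top at_top"
    by (rule filterlim_tendsto_pos_mult_at_top[OF tendsto_const])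
       (auto intro: filterlim_pow_at_top filterlim_ident)
  then have "((\<lambda>x::real. exp (- (x\<^sup>2 / 2))) \<longlongrightarrow> 0) at_top"
    by (intro filterlim_compose[OF exp_at_bot] filterlim_uminus_at_bot[THEN iffD2]) simp
  then have "((\<lambda>x::real. 1 / sqrt (2 * pi) * exp (- (x\<^sup>2 / 2))) \<longlongrightarrow> 1 / sqrt (2 * pi) * 0) at_top"
    by (rule tendsto_mult_left)
  then show *: "(std_normal_density \<longlongrightarrow> 0) at_top" by (simp add: std_normal_density_def[abs_def])
  then show "(std_normal_density \<longlongrightarrow> 0) at_bot"
    by (simp add: filterlim_at_bot_mirror std_normal_density_def[abs_def])
qed

text \<open>
The standard normal density \<open>\<rho>\<close> satisfies \<open>\<rho>'(x) = - x \<rho>(x)\<close>; integrate the derivative of \<open>f \<rho>\<close>,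
which vanishes at both ends.
\<close>

lemma std_normal_integration_by_parts:
  assumes f: "\<And>x. (f has_real_derivative f' x) (at x)" "continuous_on UNIV f'"
    and bound: "\<And>x. \<bar>f x\<bar> \<le> B" "\<And>x. \<bar>f' x\<bar> \<le> B'"
  shows "(\<integral>x. x * f x \<partial>std_normal_distribution) = (\<integral>x. f' x \<partial>std_normal_distribution)"
proof -
  let ?\<rho> = std_normal_density
  have cf: "continuous_on UNIV f" using f(1) by (intro DERIV_continuous_on) (auto intro: has_field_derivative_at_within)
  have [measurable]: "f \<in> borel_measurable borel" "f' \<in> borel_measurable borel"
    using cf f(2) by (auto intro: borel_measurable_continuous_onI)
  have I1: "integrable lborel (\<lambda>x. ?\<rho> x * f' x)"
  proof (rule Bochner_Integration.integrable_bound)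
    show "integrable lborel (\<lambda>x. ?\<rho> x * \<bar>x\<bar> ^ 0 * B')"
      using integrable_std_normal_moment_abs[of 0] by (intro integrable_mult_left) simp
    show "AE x in lborel. norm (?\<rho> x * f' x) \<le> norm (?\<rho> x * \<bar>x\<bar> ^ 0 * B')"
      using bound(2) order_trans[OF abs_ge_zero bound(2)] by (intro AE_I2) (simp add: abs_mult mult_left_mono)
  qed simp
  have I2: "integrable lborel (\<lambda>x. ?\<rho> x * (x * f x))"
  proof (rule Bochner_Integration.integrable_bound)
    show "integrable lborel (\<lambda>x. ?\<rho> x * \<bar>x\<bar> ^ 1 * B)"
      using integrable_std_normal_moment_abs[of 1] by (intro integrable_mult_left) simp
    show "AE x in lborel. norm (?\<rho> x * (x * f x)) \<le> norm (?\<rho> x * \<bar>x\<bar> ^ 1 * B)"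
      using bound(1) order_trans[OF abs_ge_zero bound(1)] by (intro AE_I2) (simp add: abs_mult mult_left_mono mult.assoc)
  qed simp
  have d\<rho>: "(?\<rho> has_real_derivative - x * ?\<rho> x) (at x)" for x
  proof -
    have "((\<lambda>x. c * exp (- x\<^sup>2 / 2)) has_real_derivative - x * (c * exp (- x\<^sup>2 / 2))) (at x)" for c :: real
      by (auto intro!: derivative_eq_intros)
    from this[of "1 / sqrt (2 * pi)"] show ?thesis unfolding std_normal_density_def[abs_def] .
  qed
  have c\<rho>: "continuous_on UNIV ?\<rho>"
    unfolding std_normal_density_def[abs_def] by (intro continuous_intros) auto
  have lim: "((\<lambda>x. f x * ?\<rho> x) \<longlongrightarrow> 0) F" if "(?\<rho> \<longlongrightarrow> 0) F" for F
  proof (rule Lim_null_comparison)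
    show "\<forall>\<^sub>F x in F. norm (f x * ?\<rho> x) \<le> B * ?\<rho> x"
      using bound(1) by (intro always_eventually allI) (simp add: abs_mult mult_right_mono)
    show "((\<lambda>x. B * ?\<rho> x) \<longlongrightarrow> 0) F" using tendsto_mult_left[OF that, of B] by simp
  qed
  have "(LBINT x=-\<infinity>..\<infinity>. f' x * ?\<rho> x - ?\<rho> x * (x * f x)) = 0 - 0"
  proof (rule interval_integral_FTC_integrable[where F="\<lambda>x. f x * ?\<rho> x"])
    fix x
    show "((\<lambda>x. f x * ?\<rho> x) has_vector_derivative f' x * ?\<rho> x - ?\<rho> x * (x * f x)) (at x)"
      unfolding has_real_derivative_iff_has_vector_derivative[symmetric]
      by (rule DERIV_cong[OF DERIV_mult[OF f(1) d\<rho>]]) simp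
    show "isCont (\<lambda>x. f' x * ?\<rho> x - ?\<rho> x * (x * f x)) x"
      using f(2) cf c\<rho> by (auto intro!: continuous_intros simp: continuous_on_eq_continuous_at)
  next
    show "set_integrable lborel (einterval (- \<infinity>) \<infinity>) (\<lambda>x. f' x * ?\<rho> x - ?\<rho> x * (x * f x))"
      using I1 I2 by (simp add: set_integrable_def mult.commute)
  qed (use std_normal_density_tendsto_0 in \<open>auto simp: ereal_tendsto_simps intro!: lim\<close>)
  then have "(\<integral>x. ?\<rho> x * f' x - ?\<rho> x * (x * f x) \<partial>lborel) = 0"
    by (simp add: interval_lebesgue_integral_def set_lebesgue_integral_def mult.commute)
  then have "(\<integral>x. ?\<rho> x * f' x \<partial>lborel) = (\<integral>x. ?\<rho> x * (x * f x) \<partial>lborel)"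
    using I1 I2 by simp
  then show ?thesis by (simp add: integral_density)
qed

locale std_normal_vec = prob_space N for N :: "'b measure" +
  fixes Z :: "'b \<Rightarrow> real ^ 'k"
  assumes std_normal: "std_normal_vector Z"
begin

lemma indep_coords: "indep_vars (\<lambda>_. borel) (\<lambda>i \<omega>. Z \<omega> $ i) UNIV"
  and distributed_coord: "distributed N lborel (\<lambda>\<omega>. Z \<omega> $ i) std_normal_density"
  using std_normal unfolding std_normal_vector_def by auto

lemma coord_measurable: "(\<lambda>\<omega>. Z \<omega> $ i) \<in> borel_measurable N"
  using distributed_measurable[OF distributed_coord] by simp

lemma distr_coord: "distr N borel (\<lambda>\<omega>. Z \<omega> $ i) = std_normal_distribution"
  using distributed_distr_eq_density[OF distributed_coord[of i]]
  by (metis distr_cong sets_lborel)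

text \<open>
Fubini for the law of \<open>Z\<close>, which is a product of standard normal laws by independence; the
coordinate \<open>j\<close> is integrated first, so that the one-dimensional formula can be used in it.
\<close>

lemma integral_split_coord:
  fixes G :: "real ^ 'k \<Rightarrow> real"
  assumes G[measurable]: "G \<in> borel_measurable borel" and int: "integrable N (\<lambda>\<omega>. G (Z \<omega>))"
  shows "(\<integral>\<omega>. G (Z \<omega>) \<partial>N) =
    (\<integral>x. (\<integral>y. G (\<chi> i. (x(j := y)) i) \<partial>std_normal_distribution) \<partial>PiM (UNIV - {j}) (\<lambda>_. std_normal_distribution))"
proof -
  let ?\<mu> = "std_normal_distribution"
  interpret \<mu>: prob_space ?\<mu> by (rule prob_space_normal_density) simp
  interpret P: product_sigma_finite "\<lambda>_::'k. ?\<mu>" ..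
  have vec: "(\<lambda>x. \<chi> i. x i) \<in> borel_measurable (PiM UNIV (\<lambda>_. borel :: real measure))"
    by (rule borel_measurable_vecI) simp
  have "distr N (PiM UNIV (\<lambda>_. borel)) (\<lambda>\<omega>. \<lambda>i\<in>UNIV. Z \<omega> $ i) = PiM UNIV (\<lambda>i. distr N borel (\<lambda>\<omega>. Z \<omega> $ i))"
    using indep_coords by (subst (asm) indep_vars_iff_distr_eq_PiM) (auto intro: coord_measurable)
  then have D: "distr N (PiM UNIV (\<lambda>_. borel)) (\<lambda>\<omega> i. Z \<omega> $ i) = PiM UNIV (\<lambda>_. ?\<mu>)"
    by (simp add: distr_coord restrict_def)
  have m: "(\<lambda>\<omega> i. Z \<omega> $ i) \<in> measurable N (PiM UNIV (\<lambda>_. borel))"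
    by (rule measurable_PiM_single') (auto intro: coord_measurable)
  have Gm: "(\<lambda>x. G (\<chi> i. x i)) \<in> borel_measurable (PiM UNIV (\<lambda>_. borel :: real measure))"
    by (rule measurable_compose[OF vec G])
  have "(\<integral>\<omega>. G (Z \<omega>) \<partial>N) = (\<integral>x. G (\<chi> i. x i) \<partial>PiM UNIV (\<lambda>_. ?\<mu>))"
    unfolding D[symmetric] by (subst integral_distr[OF m Gm]) simp
  moreover have "integrable (PiM UNIV (\<lambda>_. ?\<mu>)) (\<lambda>x. G (\<chi> i. x i))"
    unfolding D[symmetric] by (subst integrable_distr_eq[OF m Gm]) (simp add: int)
  moreover have "insert j (UNIV - {j}) = UNIV" by auto
  ultimately show ?thesis
    using P.product_integral_insert[of "UNIV - {j}" j "\<lambda>x. G (\<chi> i. x i)"] by simp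
qed

lemma measurable_Z[measurable]: "Z \<in> borel_measurable N"
  by (rule borel_measurable_vecI) (rule coord_measurable)

lemma coord_moments:
  "integrable N (\<lambda>\<omega>. Z \<omega> $ i)"
  "integrable N (\<lambda>\<omega>. Z \<omega> $ i * Z \<omega> $ j)" "(\<integral>\<omega>. Z \<omega> $ i * Z \<omega> $ j \<partial>N) = (if i = j then 1 else 0)"
proof -
  have 1: "integrable N (\<lambda>\<omega>. Z \<omega> $ i)" for i
    using distributed_integrable[OF distributed_coord[of i], of "\<lambda>x. x"] integrable_std_normal_moment[of 1] by simp
  show "integrable N (\<lambda>\<omega>. Z \<omega> $ i)" by (rule 1)
  have 0: "(\<integral>\<omega>. Z \<omega> $ i \<partial>N) = 0" for i
    using distributed_integral[OF distributed_coord[of i], of "\<lambda>x. x"] integral_std_normal_moment_odd[of 0] by simp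
  have 2: "integrable N (\<lambda>\<omega>. Z \<omega> $ i * Z \<omega> $ j) \<and> (\<integral>\<omega>. Z \<omega> $ i * Z \<omega> $ j \<partial>N) = (if i = j then 1 else 0)"
  proof (cases "i = j")
    case True
    then show ?thesis
      using distributed_integrable[OF distributed_coord[of i], of "\<lambda>x. x * x"] integrable_std_normal_moment[of 2]
        distributed_integral[OF distributed_coord[of i], of "\<lambda>x. x * x"] integral_std_normal_moment_even[of 1]
      by (simp add: power2_eq_square)
  next
    case False
    have "indep_vars (\<lambda>_. borel) (\<lambda>i \<omega>. Z \<omega> $ i) {i, j}"
      by (rule indep_vars_subset[OF indep_coords]) auto
    from indep_vars_lebesgue_integral[OF _ this] indep_vars_integrable[OF _ this] 1 False
    show ?thesis by (simp add: 0)
  qed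
  then show "integrable N (\<lambda>\<omega>. Z \<omega> $ i * Z \<omega> $ j)" "(\<integral>\<omega>. Z \<omega> $ i * Z \<omega> $ j \<partial>N) = (if i = j then 1 else 0)"
    by auto
qed

lemma gaussian_integration_by_parts:
  fixes F :: "real ^ 'k \<Rightarrow> real"
  assumes F: "\<And>z. GDERIV F z :> DF z" "continuous_on UNIV DF"
    and bound: "\<And>z. \<bar>F z\<bar> \<le> B" "\<And>z. norm (DF z) \<le> B'"
  shows "(\<integral>\<omega>. Z \<omega> $ j * F (Z \<omega>) \<partial>N) = (\<integral>\<omega>. DF (Z \<omega>) $ j \<partial>N)"
proof -
  have "continuous_on UNIV F" by (rule GDERIV_imp_continuous_on[OF F(1)])
  then have [measurable]: "F \<in> borel_measurable borel" "DF \<in> borel_measurable borel"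
    using F(2) by (auto intro: borel_measurable_continuous_onI)
  have i1: "integrable N (\<lambda>\<omega>. Z \<omega> $ j * F (Z \<omega>))"
  proof (rule Bochner_Integration.integrable_bound)
    show "integrable N (\<lambda>\<omega>. Z \<omega> $ j * B)" using coord_moments(1) by simp
    show "AE \<omega> in N. norm (Z \<omega> $ j * F (Z \<omega>)) \<le> norm (Z \<omega> $ j * B)"
      using bound(1) order_trans[OF bound(1) abs_ge_self] by (intro AE_I2) (simp add: abs_mult mult_left_mono)
  qed measurable
  have i2: "integrable N (\<lambda>\<omega>. DF (Z \<omega>) $ j)"
    using component_le_norm_cart[of "DF _" j] order_trans[OF _ bound(2)]
    by (intro integrable_const_bound[where B=B']) auto
  have line: "(\<integral>y. (\<chi> i. (x(j := y)) i) $ j * F (\<chi> i. (x(j := y)) i) \<partial>std_normal_distribution)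
      = (\<integral>y. DF (\<chi> i. (x(j := y)) i) $ j \<partial>std_normal_distribution)" for x
  proof -
    let ?c = "\<lambda>y. \<chi> i. (x(j := y)) i"
    have c: "?c = (\<lambda>y. ?c 0 + y *\<^sub>R axis j 1)" by (auto simp: vec_eq_iff axis_def fun_eq_iff)
    have dc: "(?c has_vector_derivative axis j 1) (at y)" for y
      by (subst c) (auto intro!: derivative_eq_intros)
    have "continuous_on UNIV ?c" by (subst c) (intro continuous_intros)
    note cc = continuous_on_compose2[OF F(2) this]
    have "(\<integral>y. y * F (?c y) \<partial>std_normal_distribution) = (\<integral>y. DF (?c y) $ j \<partial>std_normal_distribution)"
    proof (rule std_normal_integration_by_parts)
      show "((\<lambda>y. F (?c y)) has_real_derivative DF (?c y) $ j) (at y)" for y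
        using GDERIV_along_curve[of F ?c y, OF F(1) dc] by (simp add: inner_axis')
      show "continuous_on UNIV (\<lambda>y. DF (?c y) $ j)" by (intro continuous_intros cc) auto
      show "\<bar>F (?c y)\<bar> \<le> B" "\<bar>DF (?c y) $ j\<bar> \<le> B'" for y
        using bound(1) order_trans[OF component_le_norm_cart bound(2)] by auto
    qed
    then show ?thesis by simp
  qed
  have "(\<integral>\<omega>. Z \<omega> $ j * F (Z \<omega>) \<partial>N) = (\<integral>x. (\<integral>y. (\<chi> i. (x(j := y)) i) $ j * F (\<chi> i. (x(j := y)) i) \<partial>std_normal_distribution)
      \<partial>PiM (UNIV - {j}) (\<lambda>_. std_normal_distribution))"
    by (rule integral_split_coord[of "\<lambda>z. z $ j * F z"]) (use i1 in \<open>measurable\<close>)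
  also have "\<dots> = (\<integral>\<omega>. DF (Z \<omega>) $ j \<partial>N)"
    unfolding line by (rule integral_split_coord[of "\<lambda>z. DF z $ j", symmetric]) (use i2 in \<open>measurable\<close>)
  finally show ?thesis .
qed

lemma inner_Z_second_moment:
  "integrable N (\<lambda>\<omega>. (w \<bullet> Z \<omega>)\<^sup>2)" "(\<integral>\<omega>. (w \<bullet> Z \<omega>)\<^sup>2 \<partial>N) = (norm w)\<^sup>2"
proof -
  have *: "(w \<bullet> z)\<^sup>2 = (\<Sum>i\<in>UNIV. \<Sum>j\<in>UNIV. (w $ i * w $ j) * (z $ i * z $ j))" for z
    by (simp add: inner_vec_def power2_eq_square sum_product algebra_simps)
  show "integrable N (\<lambda>\<omega>. (w \<bullet> Z \<omega>)\<^sup>2)" unfolding * using coord_moments(2) by simp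
  have "(\<integral>\<omega>. (w \<bullet> Z \<omega>)\<^sup>2 \<partial>N) = (\<Sum>i\<in>UNIV. \<Sum>j\<in>UNIV. (w $ i * w $ j) * (if i = j then 1 else 0))"
    unfolding * using coord_moments(2) by (simp add: coord_moments(3) cong: if_cong)
  also have "\<dots> = (\<Sum>i\<in>UNIV. \<Sum>j\<in>UNIV. if i = j then w $ i * w $ j else 0)"
    by (intro sum.cong refl) auto
  also have "\<dots> = (norm w)\<^sup>2" by (simp add: power2_norm_eq_inner inner_vec_def)
  finally show "(\<integral>\<omega>. (w \<bullet> Z \<omega>)\<^sup>2 \<partial>N) = (norm w)\<^sup>2" .
qed

lemma norm_Z_second_moment:
  "integrable N (\<lambda>\<omega>. (norm (Z \<omega>))\<^sup>2)" "(\<integral>\<omega>. (norm (Z \<omega>))\<^sup>2 \<partial>N) = real CARD('k)"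
  unfolding power2_norm_eq_inner inner_vec_def using coord_moments(2) by (simp_all add: coord_moments(3))

end

section \<open>The path from the projection to the Gaussian vector\<close>

context pair_prob_space
begin

lemma integrable_of_fst:
  fixes f :: "'a \<Rightarrow> real"
  assumes "integrable M1 f"
  shows "integrable (M1 \<Otimes>\<^sub>M M2) (\<lambda>z. f (fst z))"
  using assms integrable_distr_eq[of fst "M1 \<Otimes>\<^sub>M M2" M1 f] M2.distr_pair_fst[of M1] by simp

lemma integrable_fst_times_snd:
  fixes f :: "'a \<Rightarrow> real" and g :: "'b \<Rightarrow> real"
  assumes f: "integrable M1 f" and g: "integrable M2 g"
  shows "integrable (M1 \<Otimes>\<^sub>M M2) (\<lambda>z. f (fst z) * g (snd z))"
proof (rule Fubini_integrable)
  have [measurable]: "f \<in> borel_measurable M1" "g \<in> borel_measurable M2" using f g by auto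
  show "(\<lambda>z. f (fst z) * g (snd z)) \<in> borel_measurable (M1 \<Otimes>\<^sub>M M2)" by measurable
  have "integrable M1 (\<lambda>x. \<bar>f x\<bar> * (\<integral>y. \<bar>g y\<bar> \<partial>M2))" using f by simp
  then show "integrable M1 (\<lambda>x. \<integral>y. norm (f (fst (x, y)) * g (snd (x, y))) \<partial>M2)" by (simp add: abs_mult)
  show "AE x in M1. integrable M2 (\<lambda>y. f (fst (x, y)) * g (snd (x, y)))" using g by simp
qed

lemma integrable_of_snd:
  fixes g :: "'b \<Rightarrow> real"
  assumes "integrable M2 g"
  shows "integrable (M1 \<Otimes>\<^sub>M M2) (\<lambda>z. g (snd z))"
  using integrable_fst_times_snd[of "\<lambda>_. 1" g] assms by simp

end

locale projection_gaussian_coupling =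
  random_projection M X \<theta> + G: std_normal_vec N Z
  for M :: "'a measure" and X :: "'a \<Rightarrow> real ^ 'd" and \<theta> :: "'a \<Rightarrow> real ^ 'd ^ 'k"
    and N :: "'b measure" and Z :: "'b \<Rightarrow> real ^ 'k" +
  fixes \<sigma> A :: real
  assumes dim: "CARD('d) \<ge> 2" and \<sigma>_pos: "\<sigma> > 0"
    and X_second_moment: "(\<integral>\<omega>. (norm (X \<omega>))\<^sup>2 \<partial>M) = \<sigma>\<^sup>2 * real CARD('d)"
    and A_def: "A = (\<integral>\<omega>. \<bar>(norm (X \<omega>))\<^sup>2 / \<sigma>\<^sup>2 - real CARD('d)\<bar> \<partial>M)"
begin

sublocale P: pair_prob_space M N ..

abbreviation "P \<equiv> M \<Otimes>\<^sub>M N"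

definition "W \<omega> = coords_in_frame (X \<omega>) (\<theta> \<omega>)"

text \<open>
The difference between \<open>\<sigma>\<^sup>2(d - 1)\<close> and \<open>\<bar>X\<bar>\<^sup>2\<close> measures how far the Gaussian and the spherical
integration by parts are from cancelling each other. The mean of \<open>radial_defect\<close> is \<open>- \<sigma>\<^sup>2\<close> and not
0, whence \<open>A + 1\<close> instead of \<open>A\<close> in the bound.
\<close>

definition "radial_defect \<omega> = \<sigma>\<^sup>2 * (real CARD('d) - 1) - (norm (X \<omega>))\<^sup>2"

definition "numerator = \<sigma> * sqrt (real CARD('k)) * (A + 1) + \<sigma> * real CARD('k)"

lemma W_measurable[measurable]: "W \<in> borel_measurable M"
  unfolding W_def[abs_def] coords_in_frame_def
  by (rule borel_measurable_vecI, simp only: vec_lambda_beta, measurable)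

lemma radial_defect_measurable[measurable]: "radial_defect \<in> borel_measurable M"
  unfolding radial_defect_def[abs_def] by measurable

lemma W_second_moment:
  "integrable M (\<lambda>\<omega>. (norm (W \<omega>))\<^sup>2)" "(\<integral>\<omega>. (norm (W \<omega>))\<^sup>2 \<partial>M) = \<sigma>\<^sup>2 * real CARD('k)"
  using second_moment_projection X_second_moment by (simp_all add: W_def[abs_def])

lemma norm_W_integrable: "integrable M (\<lambda>\<omega>. norm (W \<omega>))"
  by (rule square_integrable_imp_integrable) (use W_second_moment in simp_all)

lemma norm_Z:
  "integrable N (\<lambda>\<eta>. norm (Z \<eta>))" "(\<integral>\<eta>. norm (Z \<eta>) \<partial>N) \<le> sqrt (real CARD('k))"
  using G.abs_expectation_le_sqrt[of "\<lambda>\<eta>. norm (Z \<eta>)" "sqrt (real CARD('k))"]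
  by (simp_all add: G.norm_Z_second_moment)

lemma inner_Z: "(\<integral>\<eta>. \<bar>w \<bullet> Z \<eta>\<bar> \<partial>N) \<le> norm w"
  using G.abs_expectation_le_sqrt[of "\<lambda>\<eta>. w \<bullet> Z \<eta>" "norm w"]
  by (simp add: G.inner_Z_second_moment)

lemma radial_defect_expectation:
  "integrable M radial_defect" "(\<integral>\<omega>. \<bar>radial_defect \<omega>\<bar> \<partial>M) \<le> \<sigma>\<^sup>2 * (A + 1)"
proof -
  show a: "integrable M radial_defect" unfolding radial_defect_def[abs_def] using X_square_integrable by simp
  have i: "integrable M (\<lambda>\<omega>. \<bar>(norm (X \<omega>))\<^sup>2 / \<sigma>\<^sup>2 - real CARD('d)\<bar>)"
    using X_square_integrable by simp
  have "(\<integral>\<omega>. \<bar>radial_defect \<omega>\<bar> \<partial>M) \<le> (\<integral>\<omega>. \<sigma>\<^sup>2 * (\<bar>(norm (X \<omega>))\<^sup>2 / \<sigma>\<^sup>2 - real CARD('d)\<bar> + 1) \<partial>M)"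
  proof (rule integral_mono)
    fix \<omega>
    have "radial_defect \<omega> = - (\<sigma>\<^sup>2 * (((norm (X \<omega>))\<^sup>2 / \<sigma>\<^sup>2 - real CARD('d)) + 1))"
      using \<sigma>_pos by (simp add: radial_defect_def algebra_simps)
    then have "\<bar>radial_defect \<omega>\<bar> = \<sigma>\<^sup>2 * \<bar>((norm (X \<omega>))\<^sup>2 / \<sigma>\<^sup>2 - real CARD('d)) + 1\<bar>"
      by (simp add: abs_mult)
    also have "\<dots> \<le> \<sigma>\<^sup>2 * (\<bar>(norm (X \<omega>))\<^sup>2 / \<sigma>\<^sup>2 - real CARD('d)\<bar> + 1)"
      by (intro mult_left_mono) auto
    finally show "\<bar>radial_defect \<omega>\<bar> \<le> \<sigma>\<^sup>2 * (\<bar>(norm (X \<omega>))\<^sup>2 / \<sigma>\<^sup>2 - real CARD('d)\<bar> + 1)" .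
  qed (use a i in auto)
  also have "\<dots> = \<sigma>\<^sup>2 * (A + 1)" using i by (simp add: A_def prob_space)
  finally show "(\<integral>\<omega>. \<bar>radial_defect \<omega>\<bar> \<partial>M) \<le> \<sigma>\<^sup>2 * (A + 1)" .
qed

text \<open>
An upper bound, for every test function, of the integrand to which the derivative of \<open>path_mean\<close>
is reduced; the test function enters only through \<open>\<bar>\<nabla>g\<bar> \<le> 1\<close>.
\<close>

definition "remainder z = \<bar>radial_defect (fst z)\<bar> * norm (Z (snd z)) + norm (W (fst z)) * \<bar>W (fst z) \<bullet> Z (snd z)\<bar>"

lemma remainder_expectation:
  "integrable P remainder" "(\<integral>z. remainder z \<partial>P) \<le> \<sigma> * numerator"
proof -
  have i1: "integrable P (\<lambda>z. \<bar>radial_defect (fst z)\<bar> * norm (Z (snd z)))"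
    by (rule P.integrable_fst_times_snd[of "\<lambda>\<omega>. \<bar>radial_defect \<omega>\<bar>" "\<lambda>\<eta>. norm (Z \<eta>)"])
       (use radial_defect_expectation norm_Z in auto)
  have i2: "integrable P (\<lambda>z. norm (W (fst z)) * \<bar>W (fst z) \<bullet> Z (snd z)\<bar>)"
  proof (rule Bochner_Integration.integrable_bound)
    show "integrable P (\<lambda>z. (norm (W (fst z)))\<^sup>2 * norm (Z (snd z)))"
      by (rule P.integrable_fst_times_snd[of "\<lambda>\<omega>. (norm (W \<omega>))\<^sup>2" "\<lambda>\<eta>. norm (Z \<eta>)"])
         (use W_second_moment norm_Z in auto)
    show "AE z in P. norm (norm (W (fst z)) * \<bar>W (fst z) \<bullet> Z (snd z)\<bar>) \<le> norm ((norm (W (fst z)))\<^sup>2 * norm (Z (snd z)))"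
    proof (rule AE_I2)
      fix z
      show "norm (norm (W (fst z)) * \<bar>W (fst z) \<bullet> Z (snd z)\<bar>) \<le> norm ((norm (W (fst z)))\<^sup>2 * norm (Z (snd z)))"
        using mult_left_mono[OF Cauchy_Schwarz_ineq2[of "W (fst z)" "Z (snd z)"] norm_ge_zero[of "W (fst z)"]]
        by (simp add: abs_mult power2_eq_square mult.assoc)
    qed
  qed measurable
  show "integrable P remainder" unfolding remainder_def[abs_def] using i1 i2 by simp
  have "(\<integral>z. remainder z \<partial>P) = (\<integral>z. \<bar>radial_defect (fst z)\<bar> * norm (Z (snd z)) \<partial>P) + (\<integral>z. norm (W (fst z)) * \<bar>W (fst z) \<bullet> Z (snd z)\<bar> \<partial>P)"
    unfolding remainder_def using i1 i2 by simp
  also have "(\<integral>z. \<bar>radial_defect (fst z)\<bar> * norm (Z (snd z)) \<partial>P) = (\<integral>\<omega>. \<bar>radial_defect \<omega>\<bar> * (\<integral>\<eta>. norm (Z \<eta>) \<partial>N) \<partial>M)"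
    using P.integral_fst'[OF i1] by simp
  also have "\<dots> = (\<integral>\<omega>. \<bar>radial_defect \<omega>\<bar> \<partial>M) * (\<integral>\<eta>. norm (Z \<eta>) \<partial>N)" by simp
  also have "\<dots> \<le> \<sigma>\<^sup>2 * (A + 1) * sqrt (real CARD('k))"
    using radial_defect_expectation norm_Z by (intro mult_mono) (auto simp: A_def)
  also have "(\<integral>z. norm (W (fst z)) * \<bar>W (fst z) \<bullet> Z (snd z)\<bar> \<partial>P) = (\<integral>\<omega>. norm (W \<omega>) * (\<integral>\<eta>. \<bar>W \<omega> \<bullet> Z \<eta>\<bar> \<partial>N) \<partial>M)"
    using P.integral_fst'[OF i2] by simp
  also have "\<dots> \<le> (\<integral>\<omega>. (norm (W \<omega>))\<^sup>2 \<partial>M)"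
  proof (rule integral_mono)
    show "integrable M (\<lambda>\<omega>. norm (W \<omega>) * (\<integral>\<eta>. \<bar>W \<omega> \<bullet> Z \<eta>\<bar> \<partial>N))" using P.integrable_fst'[OF i2] by simp
    fix \<omega> show "norm (W \<omega>) * (\<integral>\<eta>. \<bar>W \<omega> \<bullet> Z \<eta>\<bar> \<partial>N) \<le> (norm (W \<omega>))\<^sup>2"
      using inner_Z[of "W \<omega>"] by (simp add: power2_eq_square mult_left_mono)
  qed (fact W_second_moment)
  also have "\<dots> = \<sigma>\<^sup>2 * real CARD('k)" by (fact W_second_moment)
  finally show "(\<integral>z. remainder z \<partial>P) \<le> \<sigma> * numerator" by (simp add: numerator_def power2_eq_square algebra_simps)
qed

end

locale interpolation = projection_gaussian_coupling M X \<theta> N Z \<sigma> A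
  for M :: "'a measure" and X :: "'a \<Rightarrow> real ^ 'd" and \<theta> :: "'a \<Rightarrow> real ^ 'd ^ 'k"
    and N :: "'b measure" and Z :: "'b \<Rightarrow> real ^ 'k" and \<sigma> A :: real +
  fixes g :: "real ^ 'k \<Rightarrow> real" and p :: "real ^ 'k \<Rightarrow> real ^ 'k" and H :: "'k \<Rightarrow> real ^ 'k \<Rightarrow> real ^ 'k" and B :: real
  assumes g: "\<And>x. GDERIV g x :> p x" and p_le_1: "\<And>x. norm (p x) \<le> 1"
    and p: "\<And>i x. GDERIV (\<lambda>x. p x $ i) x :> H i x"
    and H: "\<And>i. continuous_on UNIV (H i)" "\<And>i x. norm (H i x) \<le> B"
begin

definition "Y \<phi> z = cos \<phi> *\<^sub>R W (fst z) + (\<sigma> * sin \<phi>) *\<^sub>R Z (snd z)"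

definition "path_mean \<phi> = (\<integral>z. g (Y \<phi> z) \<partial>P)"

lemma g_lipschitz: "\<bar>g x - g y\<bar> \<le> norm (x - y)"
  using bounded_gradient_imp_lipschitz[OF g p_le_1] by simp

lemma test_function_measurable[measurable]:
  "g \<in> borel_measurable borel" "p \<in> borel_measurable borel" "H i \<in> borel_measurable borel"
proof -
  show "g \<in> borel_measurable borel"
    by (intro borel_measurable_continuous_onI GDERIV_imp_continuous_on[OF g])
  show "p \<in> borel_measurable borel"
    by (intro borel_measurable_vecI borel_measurable_continuous_onI GDERIV_imp_continuous_on[OF p])
  show "H i \<in> borel_measurable borel" using H(1) by (rule borel_measurable_continuous_onI)
qed

lemma Y_measurable[measurable]: "Y \<phi> \<in> borel_measurable P"
  unfolding Y_def[abs_def] by measurable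

lemma norm_W_P: "integrable P (\<lambda>z. norm (W (fst z)))"
  by (rule P.integrable_of_fst[OF norm_W_integrable])

lemma norm_Z_P: "integrable P (\<lambda>z. norm (Z (snd z)))"
  by (rule P.integrable_of_snd[OF norm_Z(1)])

lemma path_mean_deriv:
  "(path_mean has_real_derivative (\<integral>z. p (Y \<phi> z) \<bullet> ((\<sigma> * cos \<phi>) *\<^sub>R Z (snd z) - sin \<phi> *\<^sub>R W (fst z)) \<partial>P)) (at \<phi>)"
proof -
  define D where "D z = p (Y \<phi> z) \<bullet> ((\<sigma> * cos \<phi>) *\<^sub>R Z (snd z) - sin \<phi> *\<^sub>R W (fst z))" for z
  define b where "b z = norm (W (fst z)) + \<sigma> * norm (Z (snd z))" for z
  have bi: "integrable P b" unfolding b_def[abs_def] using norm_W_P norm_Z_P by simp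
  have b0: "0 \<le> b z" for z using \<sigma>_pos by (simp add: b_def)
  have comb: "norm (x *\<^sub>R W (fst z) + (\<sigma> * y) *\<^sub>R Z (snd z)) \<le> c * b z" if "\<bar>x\<bar> \<le> c" "\<bar>y\<bar> \<le> c" for x y c z
  proof -
    have "norm (x *\<^sub>R W (fst z) + (\<sigma> * y) *\<^sub>R Z (snd z)) \<le> \<bar>x\<bar> * norm (W (fst z)) + \<bar>y\<bar> * (\<sigma> * norm (Z (snd z)))"
      using norm_triangle_ineq[of "x *\<^sub>R W (fst z)" "(\<sigma> * y) *\<^sub>R Z (snd z)"] \<sigma>_pos by (simp add: abs_mult mult.assoc mult.left_commute)
    also have "\<dots> \<le> c * norm (W (fst z)) + c * (\<sigma> * norm (Z (snd z)))"
      using that \<sigma>_pos by (intro add_mono mult_right_mono) auto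
    finally show ?thesis by (simp add: b_def distrib_left)
  qed
  have Ylip: "norm (Y s z - Y t z) \<le> \<bar>s - t\<bar> * b z" for s t z
    using comb[of "cos s - cos t" "\<bar>s - t\<bar>" "sin s - sin t" z] trig_lipschitz[of s t]
    by (simp add: Y_def algebra_simps)
  have int: "integrable P (\<lambda>z. g (Y s z))" for s
  proof (rule P.integrable_lipschitz_comp[OF g_lipschitz])
    show "integrable P (\<lambda>z. norm (Y s z))"
    proof (rule Bochner_Integration.integrable_bound[OF bi])
      show "AE z in P. norm (norm (Y s z)) \<le> norm (b z)"
      proof (rule AE_I2)
        fix z show "norm (norm (Y s z)) \<le> norm (b z)"
          using comb[of "cos s" 1 "sin s" z] b0[of z] unfolding Y_def by simp
      qed
    qed measurable
  qed measurable
  have "GDERIV (\<lambda>s. \<integral>z. g (Y s z) \<partial>P) \<phi> :> (\<integral>z. D z \<partial>P)"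
  proof (rule GDERIV_integral(2)[OF zero_less_one int _ _ bi b0])
    fix z
    have "((\<lambda>s. Y s z) has_vector_derivative ((\<sigma> * cos \<phi>) *\<^sub>R Z (snd z) - sin \<phi> *\<^sub>R W (fst z))) (at \<phi>)"
      unfolding Y_def by (auto intro!: derivative_eq_intros simp: has_vector_derivative_def algebra_simps)
    from GDERIV_along_curve[of g "\<lambda>s. Y s z", OF g this]
    show "GDERIV (\<lambda>s. g (Y s z)) \<phi> :> D z" by (simp add: D_def inner_commute)
  next
    show "D \<in> borel_measurable P" unfolding D_def by measurable
  next
    fix s z
    show "\<bar>g (Y s z) - g (Y \<phi> z)\<bar> \<le> b z * norm (s - \<phi>)"
      using g_lipschitz[of "Y s z" "Y \<phi> z"] Ylip[of s z \<phi>] by (simp add: mult.commute)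
  qed
  then show ?thesis by (simp add: path_mean_def[abs_def] D_def)
qed

text \<open>
The contractions of the gradient and of the Hessian of \<open>g\<close> at \<open>Y \<phi>\<close> that occur in the derivative
of \<open>path_mean\<close>; \<open>hessian_W\<close> is the Hessian as a quadratic form in \<open>W\<close>.
\<close>

definition "grad_W \<phi> z = p (Y \<phi> z) \<bullet> W (fst z)"
definition "grad_Z \<phi> z = p (Y \<phi> z) \<bullet> Z (snd z)"
definition "laplacian \<phi> z = (\<Sum>i\<in>UNIV. H i (Y \<phi> z) $ i)"
definition "hessian_W \<phi> z = (\<Sum>i\<in>UNIV. W (fst z) $ i * (W (fst z) \<bullet> H i (Y \<phi> z)))"

lemma contractions_measurable[measurable]:
  "grad_W \<phi> \<in> borel_measurable P" "grad_Z \<phi> \<in> borel_measurable P" "laplacian \<phi> \<in> borel_measurable P" "hessian_W \<phi> \<in> borel_measurable P"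
  unfolding grad_W_def[abs_def] grad_Z_def[abs_def] laplacian_def[abs_def] hessian_W_def[abs_def] by measurable

lemma contractions_bounds:
  "\<bar>grad_W \<phi> z\<bar> \<le> norm (W (fst z))" "\<bar>grad_Z \<phi> z\<bar> \<le> norm (Z (snd z))"
  "\<bar>laplacian \<phi> z\<bar> \<le> real CARD('k) * B" "\<bar>hessian_W \<phi> z\<bar> \<le> real CARD('k) * B * (norm (W (fst z)))\<^sup>2"
proof -
  show "\<bar>grad_W \<phi> z\<bar> \<le> norm (W (fst z))" "\<bar>grad_Z \<phi> z\<bar> \<le> norm (Z (snd z))"
    unfolding grad_W_def grad_Z_def
    using Cauchy_Schwarz_ineq2[of "p (Y \<phi> z)" "W (fst z)"] Cauchy_Schwarz_ineq2[of "p (Y \<phi> z)" "Z (snd z)"]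
      mult_right_mono[OF p_le_1[of "Y \<phi> z"], of "norm (W (fst z))"] mult_right_mono[OF p_le_1[of "Y \<phi> z"], of "norm (Z (snd z))"]
    by simp_all
  have "\<bar>H i (Y \<phi> z) $ i\<bar> \<le> B" for i
    using component_le_norm_cart[of "H i (Y \<phi> z)" i] H(2)[of i "Y \<phi> z"] by linarith
  then show "\<bar>laplacian \<phi> z\<bar> \<le> real CARD('k) * B"
    unfolding laplacian_def using sum_bounded_above[of UNIV "\<lambda>i. \<bar>H i (Y \<phi> z) $ i\<bar>" B]
    by (intro order_trans[OF sum_abs]) simp
  have "\<bar>W (fst z) $ i * (W (fst z) \<bullet> H i (Y \<phi> z))\<bar> \<le> B * (norm (W (fst z)))\<^sup>2" for i
  proof -
    have "\<bar>W (fst z) $ i * (W (fst z) \<bullet> H i (Y \<phi> z))\<bar> \<le> norm (W (fst z)) * (norm (W (fst z)) * B)"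
      unfolding abs_mult
      by (intro mult_mono component_le_norm_cart order_trans[OF Cauchy_Schwarz_ineq2] mult_left_mono H(2)) auto
    then show ?thesis by (simp add: power2_eq_square mult.commute mult.left_commute)
  qed
  then show "\<bar>hessian_W \<phi> z\<bar> \<le> real CARD('k) * B * (norm (W (fst z)))\<^sup>2"
    unfolding hessian_W_def using sum_bounded_above[of UNIV "\<lambda>i. \<bar>W (fst z) $ i * (W (fst z) \<bullet> H i (Y \<phi> z))\<bar>" "B * (norm (W (fst z)))\<^sup>2"]
    by (intro order_trans[OF sum_abs]) (simp add: mult.assoc)
qed

lemma contractions_integrable:
  "integrable P (grad_W \<phi>)" "integrable P (grad_Z \<phi>)" "integrable P (hessian_W \<phi>)"
  "integrable M \<alpha> \<Longrightarrow> integrable P (\<lambda>z. \<alpha> (fst z) * grad_Z \<phi> z)"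
  "integrable M \<alpha> \<Longrightarrow> integrable P (\<lambda>z. \<alpha> (fst z) * laplacian \<phi> z)"
  "integrable P (\<lambda>z. grad_W \<phi> z * (W (fst z) \<bullet> Z (snd z)))"
proof -
  show "integrable P (grad_W \<phi>)"
    by (rule Bochner_Integration.integrable_bound[OF norm_W_P]) (use contractions_bounds(1) in auto)
  show "integrable P (grad_Z \<phi>)"
    by (rule Bochner_Integration.integrable_bound[OF norm_Z_P]) (use contractions_bounds(2) in auto)
  have "integrable P (\<lambda>z. real CARD('k) * B * (norm (W (fst z)))\<^sup>2)"
    using P.integrable_of_fst[OF W_second_moment(1)] by simp
  then show "integrable P (hessian_W \<phi>)"
    by (rule Bochner_Integration.integrable_bound)
       (use contractions_bounds(4) order_trans[OF contractions_bounds(4) abs_ge_self] in auto)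
  show "integrable P (\<lambda>z. \<alpha> (fst z) * grad_Z \<phi> z)" if \<alpha>: "integrable M \<alpha>"
  proof -
    have [measurable]: "\<alpha> \<in> borel_measurable M" using \<alpha> by auto
    show ?thesis
      by (rule Bochner_Integration.integrable_bound[OF P.integrable_fst_times_snd[OF \<alpha> norm_Z(1)]])
         (auto simp: abs_mult intro!: mult_left_mono contractions_bounds(2))
  qed
  show "integrable P (\<lambda>z. \<alpha> (fst z) * laplacian \<phi> z)" if \<alpha>: "integrable M \<alpha>"
  proof -
    have [measurable]: "\<alpha> \<in> borel_measurable M" using \<alpha> by auto
    have B: "\<bar>laplacian \<phi> z\<bar> \<le> \<bar>real CARD('k) * B\<bar>" for z using contractions_bounds(3)[of \<phi> z] by linarith
    show ?thesis
      by (rule Bochner_Integration.integrable_bound[OF integrable_mult_left[OF P.integrable_of_fst[OF \<alpha>], of "real CARD('k) * B"]])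
         (use B in \<open>auto simp: abs_mult intro!: mult_left_mono\<close>)
  qed
  show "integrable P (\<lambda>z. grad_W \<phi> z * (W (fst z) \<bullet> Z (snd z)))"
  proof (rule Bochner_Integration.integrable_bound[OF P.integrable_fst_times_snd[OF W_second_moment(1) norm_Z(1)]])
    show "AE z in P. norm (grad_W \<phi> z * (W (fst z) \<bullet> Z (snd z))) \<le> norm ((norm (W (fst z)))\<^sup>2 * norm (Z (snd z)))"
    proof (rule AE_I2)
      fix z
      have "\<bar>grad_W \<phi> z\<bar> * \<bar>W (fst z) \<bullet> Z (snd z)\<bar> \<le> norm (W (fst z)) * (norm (W (fst z)) * norm (Z (snd z)))"
        by (intro mult_mono contractions_bounds Cauchy_Schwarz_ineq2) auto
      then show "norm (grad_W \<phi> z * (W (fst z) \<bullet> Z (snd z))) \<le> norm ((norm (W (fst z)))\<^sup>2 * norm (Z (snd z)))"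
        by (simp add: abs_mult power2_eq_square mult.assoc)
    qed
  qed measurable
qed

text \<open>
Gaussian integration by parts conditionally on \<open>(X, \<theta>)\<close>, for the matrix of coefficients
\<open>\<alpha> I + \<beta> W W\<^sup>T\<close>. It is used from left to right with \<open>\<alpha> = 1\<close>, \<open>\<beta> = 0\<close>, and from right to left with
\<open>\<alpha> = radial_defect\<close>, \<open>\<beta> = 1\<close>.
\<close>

lemma gaussian_step:
  assumes \<alpha>: "integrable M \<alpha>"
  shows "(\<integral>z. \<alpha> (fst z) * grad_Z \<phi> z + \<beta> * (grad_W \<phi> z * (W (fst z) \<bullet> Z (snd z))) \<partial>P)
    = \<sigma> * sin \<phi> * (\<integral>z. \<alpha> (fst z) * laplacian \<phi> z + \<beta> * hessian_W \<phi> z \<partial>P)"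
proof -
  let ?L = "\<lambda>z. \<alpha> (fst z) * grad_Z \<phi> z + \<beta> * (grad_W \<phi> z * (W (fst z) \<bullet> Z (snd z)))"
  let ?R = "\<lambda>z. \<alpha> (fst z) * laplacian \<phi> z + \<beta> * hessian_W \<phi> z"
  have iL: "integrable P ?L" and iR: "integrable P ?R"
    using contractions_integrable \<alpha> by auto
  have "(\<integral>\<eta>. ?L (\<omega>, \<eta>) \<partial>N) = \<sigma> * sin \<phi> * (\<integral>\<eta>. ?R (\<omega>, \<eta>) \<partial>N)" if "\<omega> \<in> space M" for \<omega>
  proof -
    let ?w = "W \<omega>"
    let ?y = "\<lambda>z. cos \<phi> *\<^sub>R ?w + (\<sigma> * sin \<phi>) *\<^sub>R z"
    define c where "c i j = (if i = j then \<alpha> \<omega> else 0) + \<beta> * (?w $ i * ?w $ j)" for i j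
    have ym: "(\<lambda>\<eta>. ?y (Z \<eta>)) \<in> borel_measurable N" by measurable
    have ibp: "(\<integral>\<eta>. Z \<eta> $ j * p (?y (Z \<eta>)) $ i \<partial>N) = (\<integral>\<eta>. \<sigma> * sin \<phi> * H i (?y (Z \<eta>)) $ j \<partial>N)" for i j
    proof -
      have "(\<integral>\<eta>. Z \<eta> $ j * p (?y (Z \<eta>)) $ i \<partial>N) = (\<integral>\<eta>. ((\<sigma> * sin \<phi>) *\<^sub>R H i (?y (Z \<eta>))) $ j \<partial>N)"
      proof (rule G.gaussian_integration_by_parts[where F="\<lambda>z. p (?y z) $ i"])
        fix z
        have "(?y has_derivative (\<lambda>h. (\<sigma> * sin \<phi>) *\<^sub>R h)) (at z)" by (auto intro!: derivative_eq_intros)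
        from has_derivative_compose[OF this p[unfolded gderiv_def]]
        show "GDERIV (\<lambda>z. p (?y z) $ i) z :> (\<sigma> * sin \<phi>) *\<^sub>R H i (?y z)" by (simp add: gderiv_def)
        show "\<bar>p (?y z) $ i\<bar> \<le> 1" using component_le_norm_cart p_le_1 by (rule order_trans)
        show "norm ((\<sigma> * sin \<phi>) *\<^sub>R H i (?y z)) \<le> \<bar>\<sigma> * sin \<phi>\<bar> * B"
          using H(2) by (simp add: mult_left_mono)
      next
        show "continuous_on UNIV (\<lambda>z. (\<sigma> * sin \<phi>) *\<^sub>R H i (?y z))"
          by (intro continuous_intros continuous_on_compose2[OF H(1)]) auto
      qed
      then show ?thesis by simp
    qed
    have iZ: "integrable N (\<lambda>\<eta>. Z \<eta> $ j * p (?y (Z \<eta>)) $ i)" for i j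
    proof (rule Bochner_Integration.integrable_bound[OF norm_Z(1)])
      show "AE \<eta> in N. norm (Z \<eta> $ j * p (?y (Z \<eta>)) $ i) \<le> norm (norm (Z \<eta>))"
      proof (rule AE_I2)
        fix \<eta>
        have "\<bar>Z \<eta> $ j\<bar> * \<bar>p (?y (Z \<eta>)) $ i\<bar> \<le> norm (Z \<eta>) * 1"
          using order_trans[OF component_le_norm_cart p_le_1]
          by (intro mult_mono component_le_norm_cart) auto
        then show "norm (Z \<eta> $ j * p (?y (Z \<eta>)) $ i) \<le> norm (norm (Z \<eta>))" by (simp add: abs_mult)
      qed
    qed measurable
    have iH: "integrable N (\<lambda>\<eta>. H i (?y (Z \<eta>)) $ j)" for i j
      using order_trans[OF component_le_norm_cart H(2)]
      by (intro G.integrable_const_bound[where B=B]) auto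
    have "(\<integral>\<eta>. ?L (\<omega>, \<eta>) \<partial>N) = (\<integral>\<eta>. (\<Sum>i\<in>UNIV. \<Sum>j\<in>UNIV. c i j * (Z \<eta> $ j * p (?y (Z \<eta>)) $ i)) \<partial>N)"
    proof (rule Bochner_Integration.integral_cong[OF refl])
      fix \<eta>
      have "(\<Sum>i\<in>UNIV. \<Sum>j\<in>UNIV. c i j * (Z \<eta> $ j * p (?y (Z \<eta>)) $ i))
        = (\<Sum>i\<in>UNIV. \<Sum>j\<in>UNIV. (if i = j then \<alpha> \<omega> * (Z \<eta> $ j * p (?y (Z \<eta>)) $ i) else 0)
            + \<beta> * ((p (?y (Z \<eta>)) $ i * ?w $ i) * (?w $ j * Z \<eta> $ j)))"
        by (intro sum.cong refl) (auto simp: c_def algebra_simps)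
      also have "\<dots> = (\<Sum>i\<in>UNIV. \<alpha> \<omega> * (Z \<eta> $ i * p (?y (Z \<eta>)) $ i))
          + \<beta> * (\<Sum>i\<in>UNIV. \<Sum>j\<in>UNIV. (p (?y (Z \<eta>)) $ i * ?w $ i) * (?w $ j * Z \<eta> $ j))"
        by (simp add: sum.distrib sum_distrib_left)
      also have "\<dots> = ?L (\<omega>, \<eta>)"
        unfolding sum_product[symmetric] sum_distrib_left[symmetric]
        by (simp add: grad_W_def grad_Z_def Y_def inner_vec_def mult.commute flip: sum_distrib_left)
      finally show "?L (\<omega>, \<eta>) = (\<Sum>i\<in>UNIV. \<Sum>j\<in>UNIV. c i j * (Z \<eta> $ j * p (?y (Z \<eta>)) $ i))" ..
    qed
    also have "\<dots> = (\<Sum>i\<in>UNIV. \<Sum>j\<in>UNIV. c i j * (\<integral>\<eta>. Z \<eta> $ j * p (?y (Z \<eta>)) $ i \<partial>N))"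
      using iZ by simp
    also have "\<dots> = (\<Sum>i\<in>UNIV. \<Sum>j\<in>UNIV. \<sigma> * sin \<phi> * (c i j * (\<integral>\<eta>. H i (?y (Z \<eta>)) $ j \<partial>N)))"
      unfolding ibp by (simp add: mult.left_commute)
    also have "\<dots> = \<sigma> * sin \<phi> * (\<integral>\<eta>. (\<Sum>i\<in>UNIV. \<Sum>j\<in>UNIV. c i j * H i (?y (Z \<eta>)) $ j) \<partial>N)"
      using iH by (simp add: sum_distrib_left)
    also have "(\<integral>\<eta>. (\<Sum>i\<in>UNIV. \<Sum>j\<in>UNIV. c i j * H i (?y (Z \<eta>)) $ j) \<partial>N) = (\<integral>\<eta>. ?R (\<omega>, \<eta>) \<partial>N)"
    proof (rule Bochner_Integration.integral_cong[OF refl])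
      fix \<eta>
      have "(\<Sum>i\<in>UNIV. \<Sum>j\<in>UNIV. c i j * H i (?y (Z \<eta>)) $ j)
        = (\<Sum>i\<in>UNIV. \<Sum>j\<in>UNIV. (if i = j then \<alpha> \<omega> * H i (?y (Z \<eta>)) $ j else 0)
            + \<beta> * (?w $ i * (?w $ j * H i (?y (Z \<eta>)) $ j)))"
        by (intro sum.cong refl) (auto simp: c_def algebra_simps)
      also have "\<dots> = ?R (\<omega>, \<eta>)"
        by (simp add: sum.distrib laplacian_def hessian_W_def Y_def inner_vec_def sum_distrib_left)
      finally show "(\<Sum>i\<in>UNIV. \<Sum>j\<in>UNIV. c i j * H i (?y (Z \<eta>)) $ j) = ?R (\<omega>, \<eta>)" .
    qed
    finally show ?thesis .
  qed
  then have "(\<integral>\<omega>. (\<integral>\<eta>. ?L (\<omega>, \<eta>) \<partial>N) \<partial>M) = \<sigma> * sin \<phi> * (\<integral>\<omega>. (\<integral>\<eta>. ?R (\<omega>, \<eta>) \<partial>N) \<partial>M)"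
    by (simp cong: Bochner_Integration.integral_cong)
  then show ?thesis unfolding P.integral_fst'[OF iL] P.integral_fst'[OF iR] .
qed

text \<open>
The rotation identity conditionally on \<open>Z\<close>, for the field \<open>w \<mapsto> \<nabla>g (cos \<phi> w + \<sigma> sin \<phi> Z)\<close>; the
chain rule produces the factor \<open>cos \<phi>\<close>.
\<close>

lemma rotation_step:
  "(real CARD('d) - 1) * (\<integral>z. grad_W \<phi> z \<partial>P) = cos \<phi> * (\<integral>z. (norm (X (fst z)))\<^sup>2 * laplacian \<phi> z - hessian_W \<phi> z \<partial>P)"
proof -
  let ?E = "\<lambda>z. cos \<phi> * ((norm (X (fst z)))\<^sup>2 * laplacian \<phi> z - hessian_W \<phi> z) - (real CARD('d) - 1) * grad_W \<phi> z"
  have i: "integrable P (\<lambda>z. (norm (X (fst z)))\<^sup>2 * laplacian \<phi> z)" by (rule contractions_integrable(5)[OF X_square_integrable])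
  have iE: "integrable P ?E" using i contractions_integrable by auto
  have "(\<integral>\<omega>. ?E (\<omega>, \<eta>) \<partial>M) = 0" if "\<eta> \<in> space N" for \<eta>
  proof -
    let ?y = "\<lambda>w. cos \<phi> *\<^sub>R w + (\<sigma> * sin \<phi>) *\<^sub>R Z \<eta>"
    have "(\<integral>\<omega>. (norm (X \<omega>))\<^sup>2 * (\<Sum>i\<in>UNIV. (cos \<phi> *\<^sub>R H i (?y (W \<omega>))) $ i)
        - (\<Sum>i\<in>UNIV. W \<omega> $ i * (W \<omega> \<bullet> (cos \<phi> *\<^sub>R H i (?y (W \<omega>)))))
        - (real CARD('d) - 1) * (p (?y (W \<omega>)) \<bullet> W \<omega>) \<partial>M) = 0"
      unfolding W_def
    proof (rule rotation_identity(2)[of "\<lambda>w. p (?y w)" "\<lambda>i w. cos \<phi> *\<^sub>R H i (?y w)" "\<bar>cos \<phi>\<bar> * B"])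
      fix i w
      have "(?y has_derivative (\<lambda>h. cos \<phi> *\<^sub>R h)) (at w)" by (auto intro!: derivative_eq_intros)
      from has_derivative_compose[OF this p[unfolded gderiv_def]]
      show "GDERIV (\<lambda>w. p (?y w) $ i) w :> cos \<phi> *\<^sub>R H i (?y w)" by (simp add: gderiv_def)
      show "norm (cos \<phi> *\<^sub>R H i (?y w)) \<le> \<bar>cos \<phi>\<bar> * B"
        using H(2) by (simp add: mult_left_mono)
    next
      fix i
      show "continuous_on UNIV (\<lambda>w. cos \<phi> *\<^sub>R H i (?y w))"
        by (intro continuous_intros continuous_on_compose2[OF H(1)]) auto
    qed
    then show ?thesis
      by (simp add: laplacian_def hessian_W_def grad_W_def Y_def sum_distrib_left right_diff_distrib mult.left_commute)
  qed
  then have "(\<integral>\<eta>. (\<integral>\<omega>. ?E (\<omega>, \<eta>) \<partial>M) \<partial>N) = 0"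
    by (simp cong: Bochner_Integration.integral_cong)
  then have "(\<integral>z. ?E z \<partial>P) = 0"
  proof -
    have "case_prod (\<lambda>\<omega> \<eta>. ?E (\<omega>, \<eta>)) = ?E" by (auto simp: fun_eq_iff)
    from P.integral_snd[of "\<lambda>\<omega> \<eta>. ?E (\<omega>, \<eta>)", unfolded this, OF iE] \<open>(\<integral>\<eta>. (\<integral>\<omega>. ?E (\<omega>, \<eta>) \<partial>M) \<partial>N) = 0\<close>
    show ?thesis by (simp only:)
  qed
  moreover have "(\<integral>z. ?E z \<partial>P) = cos \<phi> * (\<integral>z. (norm (X (fst z)))\<^sup>2 * laplacian \<phi> z - hessian_W \<phi> z \<partial>P) - (real CARD('d) - 1) * (\<integral>z. grad_W \<phi> z \<partial>P)"
    using i contractions_integrable by simp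
  ultimately show ?thesis by simp
qed

text \<open>
The two steps turn both parts of the derivative into second order terms with the common factor
\<open>sin \<phi> cos \<phi>\<close>. The Gaussian step read backwards uses up \<open>\<sigma> sin \<phi>\<close> and restores a first order
term, which is at most \<open>remainder\<close>; no division by \<open>sin \<phi>\<close> is involved.
\<close>

lemma path_mean_deriv_bound:
  "\<exists>h'. (path_mean has_real_derivative h') (at \<phi>) \<and> \<bar>h'\<bar> \<le> \<bar>cos \<phi>\<bar> * (numerator / (real CARD('d) - 1))"
proof (intro exI conjI)
  let ?n = "real CARD('d) - 1"
  let ?h' = "\<integral>z. p (Y \<phi> z) \<bullet> ((\<sigma> * cos \<phi>) *\<^sub>R Z (snd z) - sin \<phi> *\<^sub>R W (fst z)) \<partial>P"
  show "(path_mean has_real_derivative ?h') (at \<phi>)" by (rule path_mean_deriv)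
  have n: "?n > 0" using dim by simp
  have iS: "integrable P (laplacian \<phi>)" using contractions_integrable(5)[of "\<lambda>_. 1" \<phi>] by simp
  have irS: "integrable P (\<lambda>z. (norm (X (fst z)))\<^sup>2 * laplacian \<phi> z)" by (rule contractions_integrable(5)[OF X_square_integrable])
  have "?h' = (\<integral>z. \<sigma> * cos \<phi> * grad_Z \<phi> z - sin \<phi> * grad_W \<phi> z \<partial>P)"
    by (simp add: grad_W_def grad_Z_def inner_diff_right)
  also have "\<dots> = \<sigma> * cos \<phi> * (\<integral>z. grad_Z \<phi> z \<partial>P) - sin \<phi> * (\<integral>z. grad_W \<phi> z \<partial>P)"
    using contractions_integrable by simp
  also have "(\<integral>z. grad_Z \<phi> z \<partial>P) = \<sigma> * sin \<phi> * (\<integral>z. laplacian \<phi> z \<partial>P)"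
    using gaussian_step[of "\<lambda>_. 1" \<phi> 0] by simp
  finally have h': "?h' = \<sigma> * cos \<phi> * (\<sigma> * sin \<phi> * (\<integral>z. laplacian \<phi> z \<partial>P)) - sin \<phi> * (\<integral>z. grad_W \<phi> z \<partial>P)" .
  have "?n * ?h' = \<sigma> * cos \<phi> * (\<sigma> * sin \<phi>) * (?n * (\<integral>z. laplacian \<phi> z \<partial>P)) - sin \<phi> * (?n * (\<integral>z. grad_W \<phi> z \<partial>P))"
    by (subst h') (simp add: algebra_simps)
  also have "\<dots> = sin \<phi> * cos \<phi> * ((\<sigma>\<^sup>2 * ?n) * (\<integral>z. laplacian \<phi> z \<partial>P) - (\<integral>z. (norm (X (fst z)))\<^sup>2 * laplacian \<phi> z - hessian_W \<phi> z \<partial>P))"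
    unfolding rotation_step by (simp add: power2_eq_square algebra_simps)
  also have "(\<sigma>\<^sup>2 * ?n) * (\<integral>z. laplacian \<phi> z \<partial>P) - (\<integral>z. (norm (X (fst z)))\<^sup>2 * laplacian \<phi> z - hessian_W \<phi> z \<partial>P)
      = (\<integral>z. (\<sigma>\<^sup>2 * ?n) * laplacian \<phi> z - ((norm (X (fst z)))\<^sup>2 * laplacian \<phi> z - hessian_W \<phi> z) \<partial>P)"
    using iS irS contractions_integrable(3) by simp
  also have "\<dots> = (\<integral>z. radial_defect (fst z) * laplacian \<phi> z + 1 * hessian_W \<phi> z \<partial>P)"
    by (intro Bochner_Integration.integral_cong refl) (simp add: radial_defect_def algebra_simps)
  finally have "\<sigma> * (?n * ?h') = cos \<phi> * (\<sigma> * sin \<phi> * (\<integral>z. radial_defect (fst z) * laplacian \<phi> z + 1 * hessian_W \<phi> z \<partial>P))"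
    by (simp add: mult.commute mult.left_commute)
  also have "\<dots> = cos \<phi> * (\<integral>z. radial_defect (fst z) * grad_Z \<phi> z + 1 * (grad_W \<phi> z * (W (fst z) \<bullet> Z (snd z))) \<partial>P)"
    by (simp only: gaussian_step[OF radial_defect_expectation(1)])
  finally have "\<bar>\<sigma> * (?n * ?h')\<bar> = \<bar>cos \<phi>\<bar> * \<bar>\<integral>z. radial_defect (fst z) * grad_Z \<phi> z + 1 * (grad_W \<phi> z * (W (fst z) \<bullet> Z (snd z))) \<partial>P\<bar>"
    by (simp only: abs_mult)
  also have "\<dots> \<le> \<bar>cos \<phi>\<bar> * (\<sigma> * numerator)"
  proof (intro mult_left_mono)
    have "\<bar>\<integral>z. radial_defect (fst z) * grad_Z \<phi> z + 1 * (grad_W \<phi> z * (W (fst z) \<bullet> Z (snd z))) \<partial>P\<bar> \<le> (\<integral>z. remainder z \<partial>P)"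
    proof (rule abs_integral_le)
      show "integrable P (\<lambda>z. radial_defect (fst z) * grad_Z \<phi> z + 1 * (grad_W \<phi> z * (W (fst z) \<bullet> Z (snd z))))"
        using contractions_integrable(4)[OF radial_defect_expectation(1)] contractions_integrable(6) by simp
      fix z
      have "\<bar>radial_defect (fst z) * grad_Z \<phi> z\<bar> \<le> \<bar>radial_defect (fst z)\<bar> * norm (Z (snd z))"
        unfolding abs_mult by (intro mult_left_mono contractions_bounds) auto
      moreover have "\<bar>grad_W \<phi> z * (W (fst z) \<bullet> Z (snd z))\<bar> \<le> norm (W (fst z)) * \<bar>W (fst z) \<bullet> Z (snd z)\<bar>"
        unfolding abs_mult by (intro mult_right_mono contractions_bounds) auto
      ultimately show "\<bar>radial_defect (fst z) * grad_Z \<phi> z + 1 * (grad_W \<phi> z * (W (fst z) \<bullet> Z (snd z)))\<bar> \<le> remainder z"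
        by (simp add: remainder_def)
    qed (rule remainder_expectation)
    then show "\<bar>\<integral>z. radial_defect (fst z) * grad_Z \<phi> z + 1 * (grad_W \<phi> z * (W (fst z) \<bullet> Z (snd z))) \<partial>P\<bar> \<le> \<sigma> * numerator"
      using remainder_expectation(2) by simp
  qed simp
  finally have "\<sigma> * (?n * \<bar>?h'\<bar>) \<le> \<sigma> * (\<bar>cos \<phi>\<bar> * numerator)"
    using n \<sigma>_pos by (simp add: abs_mult mult.left_commute)
  then have "?n * \<bar>?h'\<bar> \<le> \<bar>cos \<phi>\<bar> * numerator" using \<sigma>_pos by simp
  then show "\<bar>?h'\<bar> \<le> \<bar>cos \<phi>\<bar> * (numerator / ?n)" using n by (simp add: field_simps)
qed

text \<open>
By the bound on the derivative, \<open>C sin \<phi> \<plusminus> path_mean \<phi>\<close> is nondecreasing on \<open>[0, \<pi>/2]\<close>.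
\<close>

lemma smooth_test_function_bound:
  "\<bar>(\<integral>\<eta>. g (\<sigma> *\<^sub>R Z \<eta>) \<partial>N) - (\<integral>\<omega>. g (W \<omega>) \<partial>M)\<bar> \<le> numerator / (real CARD('d) - 1)"
proof -
  let ?C = "numerator / (real CARD('d) - 1)"
  \<comment> \<open>The two signs \<open>\<epsilon>\<close> give the upper and the lower estimate.\<close>
  have mono: "?C * sin 0 + \<epsilon> * path_mean 0 \<le> ?C * sin (pi / 2) + \<epsilon> * path_mean (pi / 2)" if "\<bar>\<epsilon>\<bar> = 1" for \<epsilon>
  proof (rule DERIV_nonneg_imp_nondecreasing[where f="\<lambda>x. ?C * sin x + \<epsilon> * path_mean x"])
    fix x :: real assume x: "0 \<le> x" "x \<le> pi / 2"
    obtain h' where h': "(path_mean has_real_derivative h') (at x)" "\<bar>h'\<bar> \<le> \<bar>cos x\<bar> * ?C"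
      using path_mean_deriv_bound by blast
    have "cos x \<ge> 0" using x by (intro cos_ge_zero) auto
    have "\<bar>\<epsilon> * h'\<bar> \<le> cos x * ?C" using h'(2) that \<open>cos x \<ge> 0\<close> by (simp add: abs_mult)
    then have "?C * cos x + \<epsilon> * h' \<ge> 0" by (simp only: mult.commute[of ?C])
    moreover have "((\<lambda>x. ?C * sin x + \<epsilon> * path_mean x) has_real_derivative ?C * cos x + \<epsilon> * h') (at x)"
      by (intro DERIV_add DERIV_cmult h'(1) DERIV_sin)
    ultimately show "\<exists>y. ((\<lambda>x. ?C * sin x + \<epsilon> * path_mean x) has_real_derivative y) (at x) \<and> 0 \<le> y" by blast
  qed simp
  have "\<bar>path_mean (pi / 2) - path_mean 0\<bar> \<le> ?C" using mono[of 1] mono[of "-1"] by simp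
  moreover have "path_mean 0 = (\<integral>\<omega>. g (W \<omega>) \<partial>M)"
  proof -
    have "path_mean 0 = (\<integral>\<omega>. g (W \<omega>) \<partial>distr P M fst)"
      unfolding path_mean_def Y_def by (subst integral_distr) simp_all
    then show ?thesis by (simp add: G.distr_pair_fst)
  qed
  moreover have "path_mean (pi / 2) = (\<integral>\<eta>. g (\<sigma> *\<^sub>R Z \<eta>) \<partial>N)"
  proof -
    have i: "integrable N (\<lambda>\<eta>. g (\<sigma> *\<^sub>R Z \<eta>))"
      by (rule G.integrable_lipschitz_comp[OF g_lipschitz]) (use norm_Z(1) in simp_all)
    have "path_mean (pi / 2) = (\<integral>z. g (\<sigma> *\<^sub>R Z (snd z)) \<partial>P)" by (simp add: path_mean_def Y_def)
    also have "\<dots> = (\<integral>\<eta>. g (\<sigma> *\<^sub>R Z \<eta>) \<partial>N)"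
      using P.integral_fst'[OF P.integrable_of_snd[OF i]] by (simp add: prob_space)
    finally show ?thesis .
  qed
  ultimately show ?thesis by simp
qed

end

context projection_gaussian_coupling
begin

lemma lipschitz_test_function_bound:
  fixes f :: "real ^ 'k \<Rightarrow> real"
  assumes f: "\<And>x y. \<bar>f x - f y\<bar> \<le> norm (x - y)"
  shows "\<bar>(\<integral>\<eta>. f (\<sigma> *\<^sub>R Z \<eta>) \<partial>N) - (\<integral>\<omega>. f (W \<omega>) \<partial>M)\<bar> \<le> numerator / (real CARD('d) - 1)"
proof (rule field_le_epsilon)
  fix e :: real assume "e > 0"
  then have "e / 2 > 0" by simp
  obtain g :: "real ^ 'k \<Rightarrow> real" and p :: "real ^ 'k \<Rightarrow> real ^ 'k" and H :: "'k \<Rightarrow> real ^ 'k \<Rightarrow> real ^ 'k" and B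
    where smooth: "\<And>x. \<bar>g x - f x\<bar> \<le> e / 2" "\<And>x. GDERIV g x :> p x" "\<And>x. norm (p x) \<le> 1"
      "\<And>i x. GDERIV (\<lambda>x. p x $ i) x :> H i x" "\<And>i. continuous_on UNIV (H i)" "\<And>i x. norm (H i x) \<le> B"
    using smooth_approximation[OF f \<open>e / 2 > 0\<close>] by blast
  interpret interpolation M X \<theta> N Z \<sigma> A g p H B by unfold_locales (fact smooth)+
  have close: "\<bar>(\<integral>x. g (U x) \<partial>m) - (\<integral>x. f (U x) \<partial>m)\<bar> \<le> e / 2"
    if "prob_space m" "U \<in> borel_measurable m" "integrable m (\<lambda>x. norm (U x))" for m :: "'z measure" and U
  proof -
    interpret m: prob_space m by fact
    have gi: "integrable m (\<lambda>x. g (U x))" and fi: "integrable m (\<lambda>x. f (U x))"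
      using m.integrable_lipschitz_comp[OF g_lipschitz] m.integrable_lipschitz_comp[OF f] that(2,3) by auto
    have "(\<integral>x. g (U x) \<partial>m) - (\<integral>x. f (U x) \<partial>m) = (\<integral>x. g (U x) - f (U x) \<partial>m)" using gi fi by simp
    also have "\<bar>\<dots>\<bar> \<le> (\<integral>x. e / 2 \<partial>m)"
      by (rule abs_integral_le) (use gi fi smooth(1) in auto)
    finally show ?thesis by (simp add: m.prob_space)
  qed
  have "\<bar>(\<integral>\<eta>. g (\<sigma> *\<^sub>R Z \<eta>) \<partial>N) - (\<integral>\<eta>. f (\<sigma> *\<^sub>R Z \<eta>) \<partial>N)\<bar> \<le> e / 2"
    by (rule close) (use norm_Z G.prob_space_axioms in auto)
  moreover have "\<bar>(\<integral>\<omega>. g (W \<omega>) \<partial>M) - (\<integral>\<omega>. f (W \<omega>) \<partial>M)\<bar> \<le> e / 2"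
    by (rule close) (use norm_W_integrable prob_space_axioms in auto)
  ultimately show "\<bar>(\<integral>\<eta>. f (\<sigma> *\<^sub>R Z \<eta>) \<partial>N) - (\<integral>\<omega>. f (W \<omega>) \<partial>M)\<bar> \<le> numerator / (real CARD('d) - 1) + e"
    using smooth_test_function_bound by linarith
qed

end

theorem theorem4:
  fixes M :: "'a measure" and N :: "'b measure"
    and X :: "'a \<Rightarrow> real ^ 'd"
    and \<theta> :: "'a \<Rightarrow> real ^ 'd ^ 'k"
    and Z :: "'b \<Rightarrow> real ^ 'k"
    and \<sigma> A :: real
  assumes "CARD('d) \<ge> 2" and "CARD('k) \<le> CARD('d)"
    and "prob_space M" and "prob_space N"
    and "\<sigma> > 0"
    and "X \<in> borel_measurable M"
    and "integrable M X" and "(\<integral>\<omega>. X \<omega> \<partial>M) = 0"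
    and "integrable M (\<lambda>\<omega>. (norm (X \<omega>))\<^sup>2)"
    and "(\<integral>\<omega>. (norm (X \<omega>))\<^sup>2 \<partial>M) = \<sigma>\<^sup>2 * real CARD('d)"
    and "integrable M (\<lambda>\<omega>. \<bar>(norm (X \<omega>))\<^sup>2 / \<sigma>\<^sup>2 - real CARD('d)\<bar>)"
    and "A = (\<integral>\<omega>. \<bar>(norm (X \<omega>))\<^sup>2 / \<sigma>\<^sup>2 - real CARD('d)\<bar> \<partial>M)"
    and "\<theta> \<in> measurable M borel_stiefel"
    and "stiefel_haar (distr M borel_stiefel \<theta>)"
    and "prob_space.indep_pair M borel X borel_stiefel \<theta>"
    and "prob_space.std_normal_vector N Z"
  shows "wasserstein_dist M (\<lambda>\<omega>. \<chi> i. X \<omega> \<bullet> \<theta> \<omega> $ i) N (\<lambda>\<omega>. \<sigma> *\<^sub>R Z \<omega>)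
    \<le> ennreal ((\<sigma> * sqrt (real CARD('k)) * (A + 1) + \<sigma> * real CARD('k)) / (real CARD('d) - 1))"
proof -
  interpret M: prob_space M by fact
  interpret N: prob_space N by fact
  interpret projection_gaussian_coupling M X \<theta> N Z \<sigma> A
    by unfold_locales (fact assms)+
  show ?thesis
    unfolding wasserstein_dist_def
  proof (rule SUP_least)
    fix f :: "real ^ 'k \<Rightarrow> real" assume "f \<in> {f. \<forall>x y. \<bar>f x - f y\<bar> \<le> norm (x - y)}"
    then have "\<bar>(\<integral>\<omega>. f (\<sigma> *\<^sub>R Z \<omega>) \<partial>N) - (\<integral>\<omega>. f (W \<omega>) \<partial>M)\<bar> \<le> numerator / (real CARD('d) - 1)"
      by (intro lipschitz_test_function_bound) auto
    then show "ennreal \<bar>(\<integral>\<omega>. f (\<sigma> *\<^sub>R Z \<omega>) \<partial>N) - (\<integral>\<omega>. f (\<chi> i. X \<omega> \<bullet> \<theta> \<omega> $ i) \<partial>M)\<bar>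
        \<le> ennreal ((\<sigma> * sqrt (real CARD('k)) * (A + 1) + \<sigma> * real CARD('k)) / (real CARD('d) - 1))"
      by (intro ennreal_leI) (simp add: W_def coords_in_frame_def numerator_def)
  qed
qed

end
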